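(* Given $(x_0,y_0)\in\operatorname{dom}h_1\times\operatorname{dom}h_2$ and $\bar\varepsilon>0$, letting $\lambda_1=D/(4M)$, the iteration-complexity for PB-SPP$(x_0,y_0,\bar\varepsilon)$ to find an $\bar\varepsilon$-saddle-point $(\bar x_k,\bar y_k)$ of the saddle-point problem is $\mathcal O\left((MD/\bar\varepsilon)^{2.5}\right)$.
   Context: Saddle-point problem. $f(x,y)$, $(x,y)\in\mathbb R^n\times\mathbb R^m$, is convex in $x$ and concave in $y$; $h_1:\mathbb R^n\to\mathbb R\cup\{+\infty\}$ and $h_2:\mathbb R^m\to\mathbb R\cup\{+\infty\}$ are proper lower semicontinuous convex with $\operatorname{dom}h_1\times\operatorname{dom}h_2\subset\operatorname{dom}f$. The problem is $\min_x\max_y\{\phi(x,y)=f(x,y)+h_1(x)-h_2(y)\}$. Assumptions: there are maps $f_x',f_y'$ on $\operatorname{dom}h_1\times\operatorname{dom}h_2$ with $f_x'(u,v)$ a subgradient of $f(\cdot,v)$ at $u$ and $f_y'(u,v)$ a supergradient of $f(u,\cdot)$ at $v$; $\|f_x'(u,v)\|\le M$ and $\|f_y'(u,v)\|\le M$ for all $(u,v)\in\operatorname{dom}h_1\times\operatorname{dom}h_2$, for some $M>0$; $\operatorname{dom}h_1\times\operatorname{dom}h_2$ is bounded with finite diameter $D>0$; the proximal mappings of $h_1$ and $h_2$ are easy to compute; the set of saddle points is nonempty. A pair $(x,y)\in\operatorname{dom}h_1\times\operatorname{dom}h_2$ is an $\bar\varepsilon$-saddle-point if $0\in\partial_{\bar\varepsilon}[\phi(\cdot,y)-\phi(x,\cdot)](x,y)$,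 i.e. $\phi(x,v)-\phi(u,y)\le\bar\varepsilon$ for all $(u,v)\in\operatorname{dom}h_1\times\operatorname{dom}h_2$. PDCP (primal-dual cutting-plane) for a pair $(g,h)$, where $h$ is proper lower semicontinuous convex, $g$ is convex with a subgradient oracle $g'$ on $\operatorname{dom}h$, and $\ell_g(u;w)=g(w)+\langle g'(w),u-w\rangle$: PDCP$(w_0,\lambda,\varepsilon)$ with $w_0\in\operatorname{dom}h$ uses $h^\lambda(u)=h(u)+\frac1{2\lambda}\|u-w_0\|^2$, $\Gamma_1=\ell_g(\cdot;w_0)$. For $j=1,2,\dots$: $w_j=\operatorname{argmin}_u\{\Gamma_j(u)+h^\lambda(u)\}$ with minimum value $m_j$; a point $\tilde w_j$ is chosen with $\tilde w_1=w_1$ and $(g+h^\lambda)(\tilde w_j)\le\tau_{j-1}(g+h^\lambda)(\tilde w_{j-1})+(1-\tau_{j-1})(g+h^\lambda)(w_j)$ for $j\ge2$; $t_j=(g+h^\lambda)(\tilde w_j)-m_j$; $\tau_j\in[0,1]$ is selected and $\Gamma_{j+1}$ is any proper lower semicontinuous convex function with $\Gamma_{j+1}\le g$ and $\Gamma_{j+1}\ge\tau_j\bar\Gamma_j+(1-\tau_j)\ell_g(\cdot;w_j)$ for some proper lower semicontinuous convex $\bar\Gamma_j\le g$ with $\bar\Gamma_j(w_j)=\Gamma_j(w_j)$ and $w_j=\operatorname{argmin}_u\{\bar\Gamma_j(u)+h^\lambda(u)\}$. It stops at the first $j$ with $t_j\le\varepsilon$ and returns $(w_j,\tilde w_j)$.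 PB-SPP$(x_0,y_0,\bar\varepsilon)$ (proximal bundle method for the saddle-point problem): for $k=1,2,\dots$, with stepsize $\lambda_k>0$, $(x_k,\tilde x_k)=\text{PDCP}(x_{k-1},\lambda_k,\bar\varepsilon/4)$ applied to $g=f(\cdot,y_{k-1})$, $g'=f_x'(\cdot,y_{k-1})$, $h=h_1$; $(y_k,\tilde y_k)=\text{PDCP}(y_{k-1},\lambda_k,\bar\varepsilon/4)$ applied to $g=-f(x_{k-1},\cdot)$, $g'=-f_y'(x_{k-1},\cdot)$, $h=h_2$; and $\bar x_k=\frac1k\sum_{i=1}^k\tilde x_i$, $\bar y_k=\frac1k\sum_{i=1}^k\tilde y_i$. Meaning of terms: the iteration-complexity counts the total number of PDCP iterations summed over all calls (proximal mappings of $h_1,h_2$ and calls to the oracles $f_x',f_y'$). The theorem itself names only $\lambda_1$, the scalar in the stepsize rule $\lambda_k=\lambda_1/\sqrt k$ that the paper's preceding proposition and its proof of this theorem use; that proof also invokes a convergence bound for PDCP obtained with $\tau_j=j/(j+2)$. *)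

theory Defs
  imports "HOL-Analysis.Analysis" "HOL-Library.Landau_Symbols"
begin

section \<open>Euclidean space of variable dimension\<close>

text \<open>
  The dimension is a natural number rather than a type, so that the constant hidden in a complexity
  bound can be chosen uniformly over all dimensions. The points of R^n are the real sequences that
  vanish from index n on. A function on R^n is an HOL function on all sequences whose values outside
  \<open>topspace (Euclidean_space n)\<close> are irrelevant.
\<close>

type_synonym rvec = "nat \<Rightarrow> real"

abbreviation Rn :: "nat \<Rightarrow> rvec set" where
  "Rn n \<equiv> topspace (Euclidean_space n)"

definition inner_n :: "nat \<Rightarrow> rvec \<Rightarrow> rvec \<Rightarrow> real" where
  "inner_n n x y = (\<Sum>i<n. x i * y i)"

definition norm_n :: "nat \<Rightarrow> rvec \<Rightarrow> real" where
  "norm_n n x = L2_set x {..<n}"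

definition dist_n :: "nat \<Rightarrow> rvec \<Rightarrow> rvec \<Rightarrow> real" where
  "dist_n n x y = norm_n n (\<lambda>i. x i - y i)"

definition average :: "nat \<Rightarrow> (nat \<Rightarrow> rvec) \<Rightarrow> rvec" where
  "average k z = (\<lambda>i. (\<Sum>j = 1..k. z j i) / real k)"


section \<open>Extended-real-valued convex functions on R^n\<close>

definition edom :: "nat \<Rightarrow> (rvec \<Rightarrow> ereal) \<Rightarrow> rvec set" where
  "edom n F = {x \<in> Rn n. F x < \<infinity>}"

definition epigraph :: "nat \<Rightarrow> (rvec \<Rightarrow> ereal) \<Rightarrow> (rvec \<times> real) set" where
  "epigraph n F = {(x, r). x \<in> Rn n \<and> F x \<le> ereal r}"

definition proper_fun :: "nat \<Rightarrow> (rvec \<Rightarrow> ereal) \<Rightarrow> bool" where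
  "proper_fun n F \<longleftrightarrow> (\<forall>x\<in>Rn n. F x \<noteq> - \<infinity>) \<and> edom n F \<noteq> {}"

text \<open>Convexity means convexity of the epigraph, so both infinite values are allowed.\<close>

definition convex_fun :: "nat \<Rightarrow> (rvec \<Rightarrow> ereal) \<Rightarrow> bool" where
  "convex_fun n F \<longleftrightarrow>
     (\<forall>(x, r) \<in> epigraph n F. \<forall>(y, s) \<in> epigraph n F. \<forall>t\<in>{0..1}.
        ((\<lambda>i. (1 - t) * x i + t * y i), (1 - t) * r + t * s) \<in> epigraph n F)"

definition lsc_fun :: "nat \<Rightarrow> (rvec \<Rightarrow> ereal) \<Rightarrow> bool" where
  "lsc_fun n F \<longleftrightarrow>
     closedin (prod_topology (Euclidean_space n) euclideanreal) (epigraph n F)"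

definition proper_lsc_convex :: "nat \<Rightarrow> (rvec \<Rightarrow> ereal) \<Rightarrow> bool" where
  "proper_lsc_convex n F \<longleftrightarrow> proper_fun n F \<and> lsc_fun n F \<and> convex_fun n F"

text \<open>The next two notions are only used at points where \<open>F\<close> is finite.\<close>

definition is_subgradient :: "nat \<Rightarrow> (rvec \<Rightarrow> ereal) \<Rightarrow> rvec \<Rightarrow> rvec \<Rightarrow> bool" where
  "is_subgradient n F x s \<longleftrightarrow>
     s \<in> Rn n \<and> (\<forall>u\<in>Rn n. F x + ereal (inner_n n s (\<lambda>i. u i - x i)) \<le> F u)"

definition is_supergradient :: "nat \<Rightarrow> (rvec \<Rightarrow> ereal) \<Rightarrow> rvec \<Rightarrow> rvec \<Rightarrow> bool" where
  "is_supergradient n F x s \<longleftrightarrow>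
     s \<in> Rn n \<and> (\<forall>u\<in>Rn n. F u \<le> F x + ereal (inner_n n s (\<lambda>i. u i - x i)))"


section \<open>The saddle-point problem\<close>

record spp =
  dim_x :: nat
  dim_y :: nat
  spp_f :: "rvec \<Rightarrow> rvec \<Rightarrow> ereal"
  spp_h1 :: "rvec \<Rightarrow> ereal"
  spp_h2 :: "rvec \<Rightarrow> ereal"
  spp_fx :: "rvec \<Rightarrow> rvec \<Rightarrow> rvec"
  spp_fy :: "rvec \<Rightarrow> rvec \<Rightarrow> rvec"

definition dom1 :: "spp \<Rightarrow> rvec set" where
  "dom1 P = edom (dim_x P) (spp_h1 P)"

definition dom2 :: "spp \<Rightarrow> rvec set" where
  "dom2 P = edom (dim_y P) (spp_h2 P)"

text \<open>All uses of \<open>spp_phi\<close> below are at points of \<open>dom1 P \<times> dom2 P\<close>, where it is finite.\<close>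

definition spp_phi :: "spp \<Rightarrow> rvec \<Rightarrow> rvec \<Rightarrow> ereal" where
  "spp_phi P x y = spp_f P x y + spp_h1 P x - spp_h2 P y"

definition is_saddle_point :: "spp \<Rightarrow> rvec \<Rightarrow> rvec \<Rightarrow> bool" where
  "is_saddle_point P x y \<longleftrightarrow> x \<in> dom1 P \<and> y \<in> dom2 P \<and>
     (\<forall>u\<in>dom1 P. \<forall>v\<in>dom2 P.
        spp_phi P x v \<le> spp_phi P x y \<and> spp_phi P x y \<le> spp_phi P u y)"

definition is_eps_saddle_point :: "spp \<Rightarrow> real \<Rightarrow> rvec \<Rightarrow> rvec \<Rightarrow> bool" where
  "is_eps_saddle_point P eps x y \<longleftrightarrow> x \<in> dom1 P \<and> y \<in> dom2 P \<and>
     (\<forall>u\<in>dom1 P. \<forall>v\<in>dom2 P. spp_phi P x v - spp_phi P u y \<le> ereal eps)"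

definition dom_distances :: "spp \<Rightarrow> real set" where
  "dom_distances P =
     {sqrt ((dist_n (dim_x P) x u)\<^sup>2 + (dist_n (dim_y P) y v)\<^sup>2) | x y u v.
        x \<in> dom1 P \<and> y \<in> dom2 P \<and> u \<in> dom1 P \<and> v \<in> dom2 P}"

definition spp_assumptions :: "spp \<Rightarrow> real \<Rightarrow> real \<Rightarrow> bool" where
  "spp_assumptions P M D \<longleftrightarrow>
     (\<forall>y\<in>Rn (dim_y P). convex_fun (dim_x P) (\<lambda>x. spp_f P x y)) \<and>
     (\<forall>x\<in>Rn (dim_x P). convex_fun (dim_y P) (\<lambda>y. - spp_f P x y)) \<and>
     proper_lsc_convex (dim_x P) (spp_h1 P) \<and>
     proper_lsc_convex (dim_y P) (spp_h2 P) \<and>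
     (\<forall>x\<in>dom1 P. \<forall>y\<in>dom2 P. \<bar>spp_f P x y\<bar> \<noteq> \<infinity>) \<and>
     (\<forall>u\<in>dom1 P. \<forall>v\<in>dom2 P.
        is_subgradient (dim_x P) (\<lambda>x. spp_f P x v) u (spp_fx P u v) \<and>
        is_supergradient (dim_y P) (\<lambda>y. spp_f P u y) v (spp_fy P u v)) \<and>
     M > 0 \<and>
     (\<forall>u\<in>dom1 P. \<forall>v\<in>dom2 P.
        norm_n (dim_x P) (spp_fx P u v) \<le> M \<and> norm_n (dim_y P) (spp_fy P u v) \<le> M) \<and>
     bdd_above (dom_distances P) \<and> D = Sup (dom_distances P) \<and> D > 0 \<and>
     (\<exists>x y. is_saddle_point P x y)"


section \<open>The primal-dual cutting-plane method\<close>

definition linearization ::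
  "nat \<Rightarrow> (rvec \<Rightarrow> ereal) \<Rightarrow> (rvec \<Rightarrow> rvec) \<Rightarrow> rvec \<Rightarrow> rvec \<Rightarrow> ereal" where
  "linearization n g g' w u = g w + ereal (inner_n n (g' w) (\<lambda>i. u i - w i))"

definition prox_term :: "nat \<Rightarrow> (rvec \<Rightarrow> ereal) \<Rightarrow> rvec \<Rightarrow> real \<Rightarrow> rvec \<Rightarrow> ereal" where
  "prox_term n h w0 lam u = h u + ereal ((dist_n n u w0)\<^sup>2 / (2 * lam))"

record pdcp_trace =
  model :: "nat \<Rightarrow> rvec \<Rightarrow> ereal"
  iter :: "nat \<Rightarrow> rvec"
  cand :: "nat \<Rightarrow> rvec"

text \<open>The gap is the quantity \<open>t\<^sub>j\<close> compared with the tolerance.\<close>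

definition pdcp_gap ::
  "nat \<Rightarrow> (rvec \<Rightarrow> ereal) \<Rightarrow> (rvec \<Rightarrow> ereal) \<Rightarrow> rvec \<Rightarrow> real \<Rightarrow> pdcp_trace \<Rightarrow> nat \<Rightarrow> ereal" where
  "pdcp_gap n g h w0 lam T j =
     (g (cand T j) + prox_term n h w0 lam (cand T j))
     - (model T j (iter T j) + prox_term n h w0 lam (iter T j))"

definition pdcp_update ::
  "nat \<Rightarrow> (rvec \<Rightarrow> ereal) \<Rightarrow> (rvec \<Rightarrow> rvec) \<Rightarrow> (rvec \<Rightarrow> ereal) \<Rightarrow> rvec \<Rightarrow> real \<Rightarrow> real
     \<Rightarrow> rvec \<Rightarrow> (rvec \<Rightarrow> ereal) \<Rightarrow> (rvec \<Rightarrow> ereal) \<Rightarrow> bool" where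
  "pdcp_update n g g' h w0 lam t w G G' \<longleftrightarrow>
     proper_lsc_convex n G' \<and> (\<forall>u\<in>Rn n. G' u \<le> g u) \<and>
     (\<exists>B. proper_lsc_convex n B \<and> (\<forall>u\<in>Rn n. B u \<le> g u) \<and> B w = G w \<and>
          is_arg_min (\<lambda>u. B u + prox_term n h w0 lam u) (\<lambda>u. u \<in> Rn n) w \<and>
          (\<forall>u\<in>Rn n. ereal t * B u + ereal (1 - t) * linearization n g g' w u \<le> G' u))"

text \<open>
  \<open>T\<close> is a maximal execution of PDCP with weights \<open>tau\<close>: iteration \<open>j\<close> is constrained exactly when
  it is reached, that is, when no earlier iteration met the stopping test. A call that never stops is
  an infinite execution, so termination is not built in; it is expressed by \<open>pdcp_stops_at\<close>.
\<close>

definition pdcp_run ::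
  "nat \<Rightarrow> (rvec \<Rightarrow> ereal) \<Rightarrow> (rvec \<Rightarrow> rvec) \<Rightarrow> (rvec \<Rightarrow> ereal) \<Rightarrow> (nat \<Rightarrow> real) \<Rightarrow> rvec
     \<Rightarrow> real \<Rightarrow> real \<Rightarrow> pdcp_trace \<Rightarrow> bool" where
  "pdcp_run n g g' h tau w0 lam eps T \<longleftrightarrow>
     (\<forall>j\<ge>1. tau j \<in> {0..1}) \<and>
     (\<forall>u\<in>Rn n. model T 1 u = linearization n g g' w0 u) \<and>
     (\<forall>j\<ge>1. (\<forall>i\<in>{1..<j}. pdcp_gap n g h w0 lam T i > ereal eps) \<longrightarrow>
        is_arg_min (\<lambda>u. model T j u + prox_term n h w0 lam u) (\<lambda>u. u \<in> Rn n) (iter T j) \<and>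
        cand T j \<in> Rn n \<and>
        (j = 1 \<longrightarrow> cand T j = iter T j) \<and>
        (j \<ge> 2 \<longrightarrow>
           g (cand T j) + prox_term n h w0 lam (cand T j)
             \<le> ereal (tau (j - 1))
                 * (g (cand T (j - 1)) + prox_term n h w0 lam (cand T (j - 1)))
               + ereal (1 - tau (j - 1)) * (g (iter T j) + prox_term n h w0 lam (iter T j))) \<and>
        (pdcp_gap n g h w0 lam T j > ereal eps \<longrightarrow>
           pdcp_update n g g' h w0 lam (tau j) (iter T j) (model T j) (model T (Suc j))))"

definition pdcp_stops_at ::
  "nat \<Rightarrow> (rvec \<Rightarrow> ereal) \<Rightarrow> (rvec \<Rightarrow> ereal) \<Rightarrow> rvec \<Rightarrow> real \<Rightarrow> real \<Rightarrow> pdcp_trace \<Rightarrow> nat \<Rightarrow> bool" where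
  "pdcp_stops_at n g h w0 lam eps T N \<longleftrightarrow>
     N \<ge> 1 \<and> pdcp_gap n g h w0 lam T N \<le> ereal eps \<and>
     (\<forall>i\<in>{1..<N}. pdcp_gap n g h w0 lam T i > ereal eps)"


section \<open>The proximal bundle method for the saddle-point problem\<close>

record pbspp_trace =
  seq_x :: "nat \<Rightarrow> rvec"
  seq_y :: "nat \<Rightarrow> rvec"
  seq_xt :: "nat \<Rightarrow> rvec"
  seq_yt :: "nat \<Rightarrow> rvec"
  call_x :: "nat \<Rightarrow> pdcp_trace"
  call_y :: "nat \<Rightarrow> pdcp_trace"

definition x_call_run ::
  "spp \<Rightarrow> (nat \<Rightarrow> real) \<Rightarrow> (nat \<Rightarrow> real) \<Rightarrow> real \<Rightarrow> pbspp_trace \<Rightarrow> nat \<Rightarrow> bool" where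
  "x_call_run P tau lam eps R k \<longleftrightarrow>
     pdcp_run (dim_x P) (\<lambda>u. spp_f P u (seq_y R (k - 1))) (\<lambda>u. spp_fx P u (seq_y R (k - 1)))
       (spp_h1 P) tau (seq_x R (k - 1)) (lam k) (eps / 4) (call_x R k)"

definition y_call_run ::
  "spp \<Rightarrow> (nat \<Rightarrow> real) \<Rightarrow> (nat \<Rightarrow> real) \<Rightarrow> real \<Rightarrow> pbspp_trace \<Rightarrow> nat \<Rightarrow> bool" where
  "y_call_run P tau lam eps R k \<longleftrightarrow>
     pdcp_run (dim_y P) (\<lambda>v. - spp_f P (seq_x R (k - 1)) v)
       (\<lambda>v i. - spp_fy P (seq_x R (k - 1)) v i)
       (spp_h2 P) tau (seq_y R (k - 1)) (lam k) (eps / 4) (call_y R k)"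

definition x_call_stops_at ::
  "spp \<Rightarrow> (nat \<Rightarrow> real) \<Rightarrow> real \<Rightarrow> pbspp_trace \<Rightarrow> nat \<Rightarrow> nat \<Rightarrow> bool" where
  "x_call_stops_at P lam eps R k N \<longleftrightarrow>
     pdcp_stops_at (dim_x P) (\<lambda>u. spp_f P u (seq_y R (k - 1)))
       (spp_h1 P) (seq_x R (k - 1)) (lam k) (eps / 4) (call_x R k) N"

definition y_call_stops_at ::
  "spp \<Rightarrow> (nat \<Rightarrow> real) \<Rightarrow> real \<Rightarrow> pbspp_trace \<Rightarrow> nat \<Rightarrow> nat \<Rightarrow> bool" where
  "y_call_stops_at P lam eps R k N \<longleftrightarrow>
     pdcp_stops_at (dim_y P) (\<lambda>v. - spp_f P (seq_x R (k - 1)) v)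
       (spp_h2 P) (seq_y R (k - 1)) (lam k) (eps / 4) (call_y R k) N"

text \<open>
  As for PDCP, outer iteration \<open>k\<close> is constrained exactly when it is reached, that is, when all
  earlier PDCP calls have stopped.
\<close>

definition pbspp_run ::
  "spp \<Rightarrow> (nat \<Rightarrow> real) \<Rightarrow> (nat \<Rightarrow> real) \<Rightarrow> real \<Rightarrow> rvec \<Rightarrow> rvec \<Rightarrow> pbspp_trace \<Rightarrow> bool" where
  "pbspp_run P tau lam eps x0 y0 R \<longleftrightarrow>
     seq_x R 0 = x0 \<and> seq_y R 0 = y0 \<and>
     (\<forall>k\<ge>1. (\<forall>i\<in>{1..<k}. (\<exists>N. x_call_stops_at P lam eps R i N) \<and>
                              (\<exists>N. y_call_stops_at P lam eps R i N)) \<longrightarrow>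
        x_call_run P tau lam eps R k \<and> y_call_run P tau lam eps R k \<and>
        (\<forall>N. x_call_stops_at P lam eps R k N \<longrightarrow>
           seq_x R k = iter (call_x R k) N \<and> seq_xt R k = cand (call_x R k) N) \<and>
        (\<forall>N. y_call_stops_at P lam eps R k N \<longrightarrow>
           seq_y R k = iter (call_y R k) N \<and> seq_yt R k = cand (call_y R k) N))"

text \<open>
  \<open>finds_within P lam eps R B\<close>: for some \<open>k\<close>, the first \<open>k\<close> outer iterations of \<open>R\<close> are completed,
  the averaged pair is an \<open>eps\<close>-saddle-point, and the PDCP iterations of these outer iterations, over
  both calls, number at most \<open>B\<close>.
\<close>

definition finds_within :: "spp \<Rightarrow> (nat \<Rightarrow> real) \<Rightarrow> real \<Rightarrow> pbspp_trace \<Rightarrow> real \<Rightarrow> bool" where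
  "finds_within P lam eps R B \<longleftrightarrow>
     (\<exists>k\<ge>1. \<exists>Nx Ny :: nat \<Rightarrow> nat.
        (\<forall>i\<in>{1..k}. x_call_stops_at P lam eps R i (Nx i) \<and>
                     y_call_stops_at P lam eps R i (Ny i)) \<and>
        is_eps_saddle_point P eps (average k (seq_xt R)) (average k (seq_yt R)) \<and>
        real (\<Sum>i = 1..k. Nx i + Ny i) \<le> B)"

end

theory Submission
  imports Defs "HOL-Real_Asymp.Real_Asymp"
begin

text \<open>
  Write \<open>r = M D / eps\<close>. Two estimates are combined: how many outer iterations are enough, and how
  long each call of PDCP can last.

  \<^bold>\<open>Outer iterations.\<close> When a call stops, the candidate minimizes the proximal subproblem up to
  \<open>eps / 4\<close>, and the subproblem grows quadratically around its model minimizer. Adding the two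
  resulting inequalities of outer iteration \<open>k\<close> bounds \<open>\<phi>(x, v) - \<phi>(u, y)\<close> at the candidates
  \<open>x\<close> and \<open>y\<close> by \<open>eps / 2\<close>, plus a telescoping difference of squared distances to \<open>(u, v)\<close> divided
  by \<open>2 \<lambda>\<^sub>k\<close>, plus an error from evaluating \<open>f\<close> at the previous iterates. Since \<open>f\<close> is \<open>M\<close>-Lipschitz in each variable, this error is
  linear in the two steps taken; it is absorbed by their quadratic proximal terms at the cost
  \<open>4 M\<^sup>2 \<lambda>\<^sub>k\<close> (\<open>gap_term_le\<close>). With \<open>\<lambda>\<^sub>k = D / (4 M sqrt k)\<close> the average over \<open>K\<close> outer iterations
  is at most \<open>eps / 2 + 4 M D / sqrt K\<close> (\<open>average_gap_le\<close>), and by convexity this also bounds the gap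
  at the averaged pair. So \<open>K\<close> about \<open>64 r\<^sup>2\<close> is enough.

  \<^bold>\<open>Inner iterations.\<close> The model left over from the previous inner iteration grows quadratically
  around the old minimizer, while the new linearization errs by at most \<open>2 M\<close> times the distance
  moved. The trade-off gives a linear recursion for the gap (\<open>pdcp_gap_recursion\<close>), which for the
  weights \<open>j / (j + 2)\<close> becomes a telescoping bound on \<open>j (j + 1) t\<^sub>j\<close>. Hence \<open>t\<^sub>j\<close> decreases like
  \<open>M D / j\<^sup>2 + M\<^sup>2 \<lambda> / j\<close>, and call \<open>k\<close> stops within \<open>O(sqrt r + r / sqrt k + 1)\<close> iterations
  (\<open>pdcp_stops\<close>).

  Summing over \<open>k \<le> K\<close> gives \<open>K sqrt r + r sqrt K + K\<close> up to constants. With \<open>K\<close> of order \<open>r\<^sup>2\<close> the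
  first term dominates, and it has order \<open>r\<close> to the power 2.5.
\<close>

section \<open>Euclidean estimates and convex combinations\<close>

lemma mem_Rn_iff: "x \<in> Rn n \<longleftrightarrow> (\<forall>i\<ge>n. x i = 0)"
  by (simp add: topspace_Euclidean_space)

lemma dist_n_commute: "dist_n n x y = dist_n n y x"
  by (simp add: dist_n_def norm_n_def L2_set_def power2_commute)

lemma dist_n_sq: "(dist_n n x y)\<^sup>2 = (\<Sum>i<n. (x i - y i)\<^sup>2)"
  by (simp add: dist_n_def norm_n_def L2_set_def sum_nonneg)

lemma abs_inner_n_le: "\<bar>inner_n n x y\<bar> \<le> norm_n n x * norm_n n y"
proof -
  have "\<bar>inner_n n x y\<bar> \<le> (\<Sum>i<n. \<bar>x i\<bar> * \<bar>y i\<bar>)"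
    unfolding inner_n_def by (metis (no_types, lifting) abs_mult sum.cong sum_abs)
  also have "\<dots> \<le> norm_n n x * norm_n n y"
    unfolding norm_n_def by (rule L2_set_mult_ineq)
  finally show ?thesis .
qed

lemma abs_inner_n_diff_le:
  assumes "norm_n n s \<le> M"
  shows "\<bar>inner_n n s (\<lambda>i. u i - w i)\<bar> \<le> M * dist_n n u w"
  unfolding dist_n_def
  by (rule order_trans[OF abs_inner_n_le])
    (use assms in \<open>auto intro!: mult_right_mono simp: norm_n_def L2_set_nonneg\<close>)

text \<open>The strong convexity of the squared distance, as an identity.\<close>

lemma dist_n_sq_segment:
  "(dist_n n (\<lambda>i. (1 - t) * x i + t * y i) w)\<^sup>2 =
     (1 - t) * (dist_n n x w)\<^sup>2 + t * (dist_n n y w)\<^sup>2 - t * (1 - t) * (dist_n n y x)\<^sup>2"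
  unfolding dist_n_sq sum_distrib_left sum_subtractf[symmetric] sum.distrib[symmetric]
  by (intro sum.cong refl) (simp add: power2_eq_square algebra_simps)

lemma segment_mem_Rn:
  "x \<in> Rn n \<Longrightarrow> y \<in> Rn n \<Longrightarrow> (\<lambda>i. (1 - t) * x i + t * y i) \<in> Rn n"
  by (simp add: mem_Rn_iff)

text \<open>
  The right-hand side is the maximum over \<open>d\<close>, attained at \<open>d = a / (2 c)\<close>. This is how a Lipschitz
  error is paid for by a proximal term, both inside PDCP and in the outer iteration.
\<close>

lemma quadratic_absorbs_linear:
  fixes a b c d :: real
  assumes "c > 0"
  shows "a * d - c * d\<^sup>2 \<le> a\<^sup>2 / (4 * c)"
proof -
  have "0 \<le> (a - 2 * c * d)\<^sup>2 / (4 * c)" using assms by simp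
  also have "\<dots> = a\<^sup>2 / (4 * c) - (a * d - c * d\<^sup>2)"
    using assms by (simp add: field_simps power2_eq_square)
  finally show ?thesis by simp
qed

lemma convex_funD:
  assumes "convex_fun n F" "x \<in> Rn n" "y \<in> Rn n" "F x \<le> ereal r" "F y \<le> ereal s"
    "0 \<le> t" "t \<le> 1"
  shows "F (\<lambda>i. (1 - t) * x i + t * y i) \<le> ereal ((1 - t) * r + t * s)"
proof -
  have "(x, r) \<in> epigraph n F" "(y, s) \<in> epigraph n F" "t \<in> {0..1}"
    using assms by (auto simp: epigraph_def)
  then have "((\<lambda>i. (1 - t) * x i + t * y i), (1 - t) * r + t * s) \<in> epigraph n F"
    using assms(1) unfolding convex_fun_def by fast
  then show ?thesis by (simp add: epigraph_def)
qed

lemma one_minus_inverse_Suc: "1 - 1 / real (Suc k) = real k / real (Suc k)"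
  by (simp add: field_simps)

lemma average_Suc:
  assumes "k \<ge> 1"
  shows "average (Suc k) z =
    (\<lambda>i. (1 - 1 / real (Suc k)) * average k z i + 1 / real (Suc k) * z (Suc k) i)"
  using assms unfolding one_minus_inverse_Suc
  by (intro ext) (simp add: average_def add_divide_distrib)

lemma convex_fun_average:
  assumes conv: "convex_fun n F" and "k \<ge> 1"
    and z: "\<And>j. j \<in> {1..k} \<Longrightarrow> z j \<in> Rn n \<and> F (z j) \<le> ereal (r j)"
  shows "average k z \<in> Rn n \<and> F (average k z) \<le> ereal ((\<Sum>j = 1..k. r j) / real k)"
  using \<open>k \<ge> 1\<close> z
proof (induction k rule: nat_induct_at_least)
  case base
  have "average 1 z = z 1" by (simp add: average_def)
  then show ?case using base by simp
next
  case (Suc k)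
  define t where "t = 1 / real (Suc k)"
  have t: "0 \<le> t" "t \<le> 1" by (simp_all add: t_def)
  have IH: "average k z \<in> Rn n" "F (average k z) \<le> ereal ((\<Sum>j = 1..k. r j) / real k)"
    using Suc by auto
  have last: "z (Suc k) \<in> Rn n" "F (z (Suc k)) \<le> ereal (r (Suc k))"
    using Suc.prems by auto
  have avg: "average (Suc k) z = (\<lambda>i. (1 - t) * average k z i + t * z (Suc k) i)"
    unfolding t_def by (rule average_Suc[OF \<open>k \<ge> 1\<close>])
  have eq: "(1 - t) * ((\<Sum>j = 1..k. r j) / real k) + t * r (Suc k) = (\<Sum>j = 1..Suc k. r j) / real (Suc k)"
    using \<open>k \<ge> 1\<close> unfolding t_def one_minus_inverse_Suc by (simp add: add_divide_distrib)
  show ?case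
    using segment_mem_Rn[OF IH(1) last(1), of t] convex_funD[OF conv IH(1) last(1) IH(2) last(2) t]
    unfolding avg eq by blast
qed

section \<open>Quadratic growth at the minimizer of a proximal subproblem\<close>

text \<open>
  Moving from the minimizer \<open>w\<close> a fraction \<open>t\<close> of the way to \<open>u\<close> cannot decrease the objective;
  after division by \<open>t\<close>, the strong convexity of the proximal term leaves \<open>1 - t\<close> times the quadratic
  gain, and \<open>t\<close> tends to \<open>0\<close>. Since \<open>G\<close> and \<open>h\<close> are extended-valued, the conclusion also records that
  both are finite at \<open>w\<close>.
\<close>

lemma prox_minimizer_growth:
  assumes G: "convex_fun n G" "\<And>u. u \<in> Rn n \<Longrightarrow> G u \<noteq> - \<infinity>"
    and h: "convex_fun n h" "\<And>u. u \<in> Rn n \<Longrightarrow> h u \<noteq> - \<infinity>"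
    and "lam > 0"
    and argmin: "is_arg_min (\<lambda>u. G u + prox_term n h w0 lam u) (\<lambda>u. u \<in> Rn n) w"
    and u: "u \<in> Rn n" "G u \<le> ereal a" "h u \<le> ereal b"
  obtains gw hw where "w \<in> Rn n" "G w = ereal gw" "h w = ereal hw"
    "gw + hw + (dist_n n w w0)\<^sup>2 / (2 * lam) + (dist_n n u w)\<^sup>2 / (2 * lam)
       \<le> a + b + (dist_n n u w0)\<^sup>2 / (2 * lam)"
proof -
  define q where "q v = (dist_n n v w0)\<^sup>2 / (2 * lam)" for v
  have w: "w \<in> Rn n"
    and min: "\<And>v. v \<in> Rn n \<Longrightarrow> G w + (h w + ereal (q w)) \<le> G v + (h v + ereal (q v))"
    using argmin unfolding is_arg_min_def prox_term_def q_def by (auto simp: not_less)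
  have upper: "G v + (h v + ereal (q v)) \<le> ereal (r + s + q v)" if "G v \<le> ereal r" "h v \<le> ereal s" for v r s
    using add_mono[OF that(1) add_right_mono[OF that(2), of "ereal (q v)"]] by (simp add: add.assoc)
  have "G w + (h w + ereal (q w)) \<le> ereal (a + b + q u)"
    using min[OF u(1)] upper[OF u(2,3)] by (rule order_trans)
  then obtain gw hw where gw: "G w = ereal gw" and hw: "h w = ereal hw"
    using G(2)[OF w] h(2)[OF w] by (cases "G w"; cases "h w") auto
  define e where "e = (dist_n n u w)\<^sup>2 / (2 * lam)"
  have along: "gw + hw + q w \<le> a + b + q u - (1 - t) * e" if t: "0 < t" "t \<le> 1" for t
  proof -
    define z where "z = (\<lambda>i. (1 - t) * w i + t * u i)"
    have t': "0 \<le> t" using t by simp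
    have z: "z \<in> Rn n" unfolding z_def by (rule segment_mem_Rn[OF w u(1)])
    have Gz: "G z \<le> ereal ((1 - t) * gw + t * a)" unfolding z_def
      by (rule convex_funD[OF G(1) w u(1) _ u(2) t' t(2)]) (simp add: gw)
    have hz: "h z \<le> ereal ((1 - t) * hw + t * b)" unfolding z_def
      by (rule convex_funD[OF h(1) w u(1) _ u(3) t' t(2)]) (simp add: hw)
    have qz: "q z = (1 - t) * q w + t * q u - t * (1 - t) * e"
      unfolding q_def z_def e_def dist_n_sq_segment by (simp add: diff_divide_distrib add_divide_distrib)
    have "gw + hw + q w \<le> ((1 - t) * gw + t * a) + ((1 - t) * hw + t * b) + q z"
      using order_trans[OF min[OF z] upper[OF Gz hz]] by (simp add: gw hw add.assoc)
    then have "t * (gw + hw + q w) \<le> t * (a + b + q u - (1 - t) * e)"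
      unfolding qz by (simp add: algebra_simps)
    then show ?thesis using t(1) by (simp only: mult_le_cancel_left_pos)
  qed
  have "gw + hw + q w + e \<le> a + b + q u"
  proof (rule field_le_epsilon)
    fix d :: real assume d: "0 < d"
    have e: "0 \<le> e" using \<open>lam > 0\<close> by (simp add: e_def)
    \<comment> \<open>Small enough for the lost fraction \<open>t e\<close> of the gain to be below \<open>d\<close>.\<close>
    define t where "t = min 1 (d / (e + 1))"
    have t: "0 < t" "t \<le> 1" using d e by (auto simp: t_def)
    have "t * e \<le> d / (e + 1) * e" using e by (intro mult_right_mono) (auto simp: t_def)
    also have "\<dots> \<le> d" using d e by (simp add: field_simps)
    finally show "gw + hw + q w + e \<le> a + b + q u + d"
      using along[OF t] by (simp add: algebra_simps)
  qed
  then show thesis using that[OF w gw hw] by (simp add: q_def e_def)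
qed

section \<open>The primal-dual cutting-plane method\<close>

text \<open>
  The common setting of the two calls made in an outer iteration. The function \<open>g\<close> enters only
  through its oracle on the domain of \<open>h\<close>, which makes \<open>g\<close> Lipschitz there. All iterates and
  candidates turn out to lie in that domain, so that the analysis can be done with real numbers.
\<close>

locale bounded_prox_problem =
  fixes n :: nat and g :: "rvec \<Rightarrow> ereal" and g' :: "rvec \<Rightarrow> rvec" and h :: "rvec \<Rightarrow> ereal"
    and w0 :: rvec and lam M D :: real
  assumes h_convex: "convex_fun n h"
    and h_not_MInf: "\<And>u. u \<in> Rn n \<Longrightarrow> h u \<noteq> - \<infinity>"
    and g_finite: "\<And>u. u \<in> edom n h \<Longrightarrow> \<bar>g u\<bar> \<noteq> \<infinity>"
    and subgradient: "\<And>u. u \<in> edom n h \<Longrightarrow> is_subgradient n g u (g' u)"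
    and norm_subgradient: "\<And>u. u \<in> edom n h \<Longrightarrow> norm_n n (g' u) \<le> M"
    and diameter: "\<And>u v. u \<in> edom n h \<Longrightarrow> v \<in> edom n h \<Longrightarrow> dist_n n u v \<le> D"
    and w0_dom: "w0 \<in> edom n h"
    and lam_pos: "lam > 0"
    and M_pos: "M > 0"
begin

definition g_real :: "rvec \<Rightarrow> real" where "g_real u = real_of_ereal (g u)"

definition h_real :: "rvec \<Rightarrow> real" where "h_real u = real_of_ereal (h u)"

definition prox_sq :: "rvec \<Rightarrow> real" where "prox_sq u = (dist_n n u w0)\<^sup>2 / (2 * lam)"

definition objective :: "rvec \<Rightarrow> real" where "objective u = g_real u + h_real u + prox_sq u"

definition model_value :: "(rvec \<Rightarrow> ereal) \<Rightarrow> rvec \<Rightarrow> real" where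
  "model_value G w = real_of_ereal (G w) + h_real w + prox_sq w"

text \<open>
  What the analysis uses of a cutting-plane model. The value \<open>\<infinity>\<close> is allowed outside the domain of \<open>h\<close>.
\<close>

definition minorant :: "(rvec \<Rightarrow> ereal) \<Rightarrow> bool" where
  "minorant G \<longleftrightarrow> convex_fun n G \<and> (\<forall>u\<in>Rn n. G u \<noteq> - \<infinity> \<and> G u \<le> g u)"

abbreviation prox_argmin :: "(rvec \<Rightarrow> ereal) \<Rightarrow> rvec \<Rightarrow> bool" where
  "prox_argmin G w \<equiv> is_arg_min (\<lambda>u. G u + prox_term n h w0 lam u) (\<lambda>u. u \<in> Rn n) w"

lemma dom_Rn: "u \<in> edom n h \<Longrightarrow> u \<in> Rn n"
  by (simp add: edom_def)

lemma g_dom: "u \<in> edom n h \<Longrightarrow> g u = ereal (g_real u)"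
  unfolding g_real_def using g_finite[of u] by (cases "g u") auto

lemma h_dom: "u \<in> edom n h \<Longrightarrow> h u = ereal (h_real u)"
  unfolding h_real_def using h_not_MInf[of u] by (cases "h u") (auto simp: edom_def)

lemma prox_term_dom: "u \<in> edom n h \<Longrightarrow> prox_term n h w0 lam u = ereal (h_real u + prox_sq u)"
  by (simp add: prox_term_def h_dom prox_sq_def)

lemma objective_dom: "u \<in> edom n h \<Longrightarrow> g u + prox_term n h w0 lam u = ereal (objective u)"
  by (simp add: prox_term_dom g_dom objective_def)

lemma linearization_dom:
  "w \<in> edom n h \<Longrightarrow>
     linearization n g g' w u = ereal (g_real w + inner_n n (g' w) (\<lambda>i. u i - w i))"
  by (simp add: linearization_def g_dom)

lemma linearization_le: "w \<in> edom n h \<Longrightarrow> u \<in> Rn n \<Longrightarrow> linearization n g g' w u \<le> g u"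
  using subgradient[of w] by (simp add: is_subgradient_def linearization_def)

lemma g_not_MInf: "u \<in> Rn n \<Longrightarrow> g u \<noteq> - \<infinity>"
  using linearization_le[OF w0_dom, of u] linearization_dom[OF w0_dom, of u] by auto

lemma g_real_lipschitz:
  assumes "u \<in> edom n h" "w \<in> edom n h"
  shows "g_real u - g_real w \<le> M * dist_n n u w"
proof -
  have "g_real u + inner_n n (g' u) (\<lambda>i. w i - u i) \<le> g_real w"
    using linearization_le[OF assms(1) dom_Rn[OF assms(2)]] linearization_dom[OF assms(1), of w]
      g_dom[OF assms(2)] by simp
  then show ?thesis
    using abs_inner_n_diff_le[OF norm_subgradient[OF assms(1)], of w u] dist_n_commute[of n u w]
    by (smt (verit))
qed

text \<open>
  The factor 2 collects the Lipschitz constant of \<open>g\<close> and the slope of the linearization.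
\<close>

lemma linearization_error:
  assumes "u \<in> edom n h" "w \<in> edom n h"
  shows "g_real u - 2 * M * dist_n n u w \<le> g_real w + inner_n n (g' w) (\<lambda>i. u i - w i)"
  using g_real_lipschitz[OF assms]
    abs_inner_n_diff_le[OF norm_subgradient[OF assms(2)], of u w]
  unfolding mult.assoc abs_le_iff by linarith

lemma minorant_linearization:
  assumes w: "w \<in> edom n h" and G: "\<And>u. u \<in> Rn n \<Longrightarrow> G u = linearization n g g' w u"
  shows "minorant G"
  unfolding minorant_def
proof (intro conjI ballI)
  have affine: "inner_n n s (\<lambda>i. ((1 - t) * x i + t * y i) - w i) =
      (1 - t) * inner_n n s (\<lambda>i. x i - w i) + t * inner_n n s (\<lambda>i. y i - w i)" for s x y t
    unfolding inner_n_def sum_distrib_left sum.distrib[symmetric]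
    by (intro sum.cong refl) (simp add: algebra_simps)
  show "convex_fun n G"
    unfolding convex_fun_def epigraph_def
  proof (clarsimp simp del: ereal_less_eq)
    fix x r y s and t :: real
    assume x: "x \<in> Rn n" "G x \<le> ereal r" and y: "y \<in> Rn n" "G y \<le> ereal s" and t: "0 \<le> t" "t \<le> 1"
    define L where "L u = g_real w + inner_n n (g' w) (\<lambda>i. u i - w i)" for u
    have L: "\<And>u. u \<in> Rn n \<Longrightarrow> G u = ereal (L u)"
      using G linearization_dom[OF w] by (simp add: L_def)
    have z: "(\<lambda>i. (1 - t) * x i + t * y i) \<in> Rn n" by (rule segment_mem_Rn[OF x(1) y(1)])
    have "L x \<le> r" "L y \<le> s" using x y L by auto
    then have "(1 - t) * L x + t * L y \<le> (1 - t) * r + t * s"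
      using t by (intro add_mono mult_left_mono) auto
    moreover have "L (\<lambda>i. (1 - t) * x i + t * y i) = (1 - t) * L x + t * L y"
      unfolding L_def affine by (simp add: algebra_simps)
    ultimately show "(\<lambda>i. (1 - t) * x i + t * y i) \<in> Rn n \<and>
        G (\<lambda>i. (1 - t) * x i + t * y i) \<le> ereal ((1 - t) * r + t * s)"
      using z L[OF z] by simp
  qed
  show "G u \<noteq> - \<infinity>" "G u \<le> g u" if "u \<in> Rn n" for u
    using G[OF that] linearization_dom[OF w, of u] linearization_le[OF w that] by auto
qed

lemma minorant_proper_lsc_convex:
  "proper_lsc_convex n G \<Longrightarrow> (\<And>u. u \<in> Rn n \<Longrightarrow> G u \<le> g u) \<Longrightarrow> minorant G"
  by (simp add: minorant_def proper_lsc_convex_def proper_fun_def)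

lemma minorant_dom:
  assumes "minorant G" "u \<in> edom n h"
  shows "G u = ereal (real_of_ereal (G u))" "real_of_ereal (G u) \<le> g_real u"
proof -
  have "G u \<noteq> - \<infinity>" "G u \<le> ereal (g_real u)"
    using assms dom_Rn[of u] g_dom[of u] by (auto simp: minorant_def)
  then show "G u = ereal (real_of_ereal (G u))" "real_of_ereal (G u) \<le> g_real u"
    by (cases "G u"; simp)+
qed

lemma model_growth:
  assumes G: "minorant G" and w: "prox_argmin G w"
  shows "w \<in> edom n h"
    and "u \<in> edom n h \<Longrightarrow> model_value G w + (dist_n n u w)\<^sup>2 / (2 * lam) \<le> model_value G u"
proof -
  have G': "convex_fun n G" "\<And>v. v \<in> Rn n \<Longrightarrow> G v \<noteq> - \<infinity>" using G by (auto simp: minorant_def)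
  have growth: "w \<in> edom n h \<and> model_value G w + (dist_n n u w)\<^sup>2 / (2 * lam) \<le> model_value G u"
    if u: "u \<in> edom n h" for u
  proof -
    have "G u \<le> ereal (real_of_ereal (G u))" "h u \<le> ereal (h_real u)"
      using minorant_dom(1)[OF G u] h_dom[OF u] by simp_all
    from prox_minimizer_growth[OF G' h_convex h_not_MInf lam_pos w dom_Rn[OF u] this]
    obtain gw hw where "w \<in> Rn n" "G w = ereal gw" "h w = ereal hw"
      "gw + hw + (dist_n n w w0)\<^sup>2 / (2 * lam) + (dist_n n u w)\<^sup>2 / (2 * lam)
       \<le> real_of_ereal (G u) + h_real u + (dist_n n u w0)\<^sup>2 / (2 * lam)" by blast
    then show ?thesis by (simp add: edom_def model_value_def h_real_def prox_sq_def)
  qed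
  show "w \<in> edom n h" using growth[OF w0_dom] by simp
  show "model_value G w + (dist_n n u w)\<^sup>2 / (2 * lam) \<le> model_value G u" if "u \<in> edom n h"
    using growth[OF that] by simp
qed

lemma model_value_le_objective:
  "minorant G \<Longrightarrow> u \<in> edom n h \<Longrightarrow> model_value G u \<le> objective u"
  using minorant_dom(2)[of G u] by (simp add: model_value_def objective_def)

text \<open>
  One inner iteration. Let \<open>d\<close> be the distance from \<open>w\<close> to \<open>w'\<close>. In the new model, the part \<open>B\<close>
  has gained \<open>d\<^sup>2 / (2 lam)\<close> over the old minimum, and the linearization part
  underestimates \<open>g\<close> by at most \<open>2 M d\<close>. With weights \<open>t\<close> and \<open>1 - t\<close>, maximizing the loss minus the
  gain over \<open>d\<close> gives the last summand, however long the step was.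
\<close>

lemma pdcp_gap_recursion:
  assumes G: "minorant G" and w: "prox_argmin G w" and c: "c \<in> edom n h"
    and t: "0 < t" "t \<le> 1"
    and upd: "pdcp_update n g g' h w0 lam t w G G'"
    and w': "prox_argmin G' w'"
    and c': "c' \<in> Rn n"
      "g c' + prox_term n h w0 lam c' \<le> ereal t * (g c + prox_term n h w0 lam c)
         + ereal (1 - t) * (g w' + prox_term n h w0 lam w')"
  shows "minorant G'" and "c' \<in> edom n h"
    and "objective c' - model_value G' w' \<le>
           t * (objective c - model_value G w) + 2 * M\<^sup>2 * lam * (1 - t)\<^sup>2 / t"
proof -
  show G': "minorant G'"
    using upd by (intro minorant_proper_lsc_convex) (auto simp: pdcp_update_def)
  have wd: "w \<in> edom n h" by (rule model_growth(1)[OF G w])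
  have wd': "w' \<in> edom n h" by (rule model_growth(1)[OF G' w'])
  \<comment> \<open>A finite objective value forces the new candidate into the domain of \<open>h\<close>.\<close>
  have cand: "g c' + prox_term n h w0 lam c' \<le> ereal (t * objective c + (1 - t) * objective w')"
    using c'(2) by (simp add: objective_dom c wd')
  then have "h c' \<noteq> \<infinity>"
    using g_not_MInf[OF c'(1)] by (cases "g c'") (auto simp: prox_term_def)
  then show cd': "c' \<in> edom n h" using c'(1) by (simp add: edom_def)
  obtain B where B': "proper_lsc_convex n B" "\<forall>u\<in>Rn n. B u \<le> g u"
    and B: "B w = G w" "prox_argmin B w"
    and low: "\<forall>u\<in>Rn n. ereal t * B u + ereal (1 - t) * linearization n g g' w u \<le> G' u"
    using upd unfolding pdcp_update_def by (elim conjE exE)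
  have Bm: "minorant B" using B' by (intro minorant_proper_lsc_convex) auto
  define b where "b = real_of_ereal (B w')"
  define l where "l = g_real w + inner_n n (g' w) (\<lambda>i. w' i - w i)"
  define d where "d = dist_n n w' w"
  have "ereal (t * b + (1 - t) * l) \<le> ereal (real_of_ereal (G' w'))"
    using bspec[OF low dom_Rn[OF wd']] minorant_dom(1)[OF Bm wd'] minorant_dom(1)[OF G' wd']
      linearization_dom[OF wd, of w'] by (metis b_def l_def plus_ereal.simps(1) times_ereal.simps(1))
  then have 1: "t * b + (1 - t) * l \<le> real_of_ereal (G' w')" by simp
  have "model_value B w + d\<^sup>2 / (2 * lam) \<le> model_value B w'"
    unfolding d_def by (rule model_growth(2)[OF Bm B(2) wd'])
  then have 2: "t * (model_value G w + d\<^sup>2 / (2 * lam)) \<le> t * (b + h_real w' + prox_sq w')"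
    using t by (intro mult_left_mono) (simp_all add: model_value_def B(1) b_def)
  have 3: "(1 - t) * (g_real w' - 2 * M * d) \<le> (1 - t) * l"
    using t linearization_error[OF wd' wd] by (intro mult_left_mono) (simp_all add: l_def d_def)
  have 4: "objective c' \<le> t * objective c + (1 - t) * objective w'"
    using cand objective_dom[OF cd'] by simp
  have "objective c' - model_value G' w'
      \<le> t * (objective c - model_value G w) + ((2 * M * (1 - t)) * d - (t / (2 * lam)) * d\<^sup>2)"
    using 1 2 3 4 unfolding model_value_def objective_def by (simp add: algebra_simps)
  also have "(2 * M * (1 - t)) * d - (t / (2 * lam)) * d\<^sup>2 \<le> (2 * M * (1 - t))\<^sup>2 / (4 * (t / (2 * lam)))"
    using t lam_pos by (intro quadratic_absorbs_linear) simp
  also have "\<dots> = 2 * M\<^sup>2 * lam * (1 - t)\<^sup>2 / t"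
    using t lam_pos by (simp add: field_simps power2_eq_square)
  finally show "objective c' - model_value G' w' \<le>
           t * (objective c - model_value G w) + 2 * M\<^sup>2 * lam * (1 - t)\<^sup>2 / t" by simp
qed

lemma pdcp_gap_dom:
  assumes "minorant (model T j)" "iter T j \<in> edom n h" "cand T j \<in> edom n h"
  shows "pdcp_gap n g h w0 lam T j =
    ereal (objective (cand T j) - model_value (model T j) (iter T j))"
  unfolding pdcp_gap_def objective_dom[OF assms(3)]
  using minorant_dom(1)[OF assms(1,2)] prox_term_dom[OF assms(2)]
  by (metis (no_types, lifting) add.assoc ereal_minus(1) model_value_def plus_ereal.simps(1))

abbreviation weight :: "nat \<Rightarrow> real" where "weight j \<equiv> real j / (real j + 2)"

lemma pdcp_iteration:
  assumes run: "pdcp_run n g g' h tau w0 lam eps T"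
    and j: "j \<ge> 1" and prev: "\<forall>i\<in>{1..<j}. pdcp_gap n g h w0 lam T i > ereal eps"
  shows "prox_argmin (model T j) (iter T j)"
    and "cand T j \<in> Rn n"
    and "j = 1 \<Longrightarrow> cand T j = iter T j"
    and "j \<ge> 2 \<Longrightarrow>
        g (cand T j) + prox_term n h w0 lam (cand T j)
          \<le> ereal (tau (j - 1)) * (g (cand T (j - 1)) + prox_term n h w0 lam (cand T (j - 1)))
            + ereal (1 - tau (j - 1)) * (g (iter T j) + prox_term n h w0 lam (iter T j))"
    and "pdcp_gap n g h w0 lam T j > ereal eps \<Longrightarrow>
        pdcp_update n g g' h w0 lam (tau j) (iter T j) (model T j) (model T (Suc j))"
proof -
  note step = run[unfolded pdcp_run_def, THEN conjunct2, THEN conjunct2, THEN spec, THEN mp, OF j,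
      THEN mp, OF prev]
  show "prox_argmin (model T j) (iter T j)" by (rule step[THEN conjunct1])
  note step = step[THEN conjunct2]
  show "cand T j \<in> Rn n" by (rule step[THEN conjunct1])
  note step = step[THEN conjunct2]
  show "cand T j = iter T j" if "j = 1" by (rule step[THEN conjunct1, THEN mp, OF that])
  note step = step[THEN conjunct2]
  show "g (cand T j) + prox_term n h w0 lam (cand T j)
          \<le> ereal (tau (j - 1)) * (g (cand T (j - 1)) + prox_term n h w0 lam (cand T (j - 1)))
            + ereal (1 - tau (j - 1)) * (g (iter T j) + prox_term n h w0 lam (iter T j))" if "j \<ge> 2"
    by (rule step[THEN conjunct1, THEN mp, OF that])
  note step = step[THEN conjunct2]
  show "pdcp_update n g g' h w0 lam (tau j) (iter T j) (model T j) (model T (Suc j))"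
    if "pdcp_gap n g h w0 lam T j > ereal eps" by (rule step[THEN mp, OF that])
qed

lemma pdcp_first_model:
  "pdcp_run n g g' h tau w0 lam eps T \<Longrightarrow> u \<in> Rn n \<Longrightarrow> model T 1 u = linearization n g g' w0 u"
  unfolding pdcp_run_def by (elim conjE) (erule bspec)

text \<open>
  For \<open>t = j / (j + 2)\<close> the last summand of the gap recursion is \<open>8 M\<^sup>2 lam / (j (j + 2))\<close>. Multiplied by
  \<open>(j + 1) (j + 2)\<close>, the recursion has the same form \<open>j (j + 1) t\<^sub>j\<close> on both sides, and each step adds
  at most \<open>16 M\<^sup>2 lam\<close>. The start \<open>4 M D\<close> is twice the error of the first linearization over the
  diameter.
\<close>

lemma pdcp_invariant:
  assumes run: "pdcp_run n g g' h weight w0 lam eps T"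
    and "j \<ge> 1" "\<forall>i\<in>{1..<j}. pdcp_gap n g h w0 lam T i > ereal eps"
  shows "minorant (model T j) \<and> prox_argmin (model T j) (iter T j) \<and> cand T j \<in> edom n h \<and>
    real j * (real j + 1) * (objective (cand T j) - model_value (model T j) (iter T j))
      \<le> 4 * M * D + 16 * M\<^sup>2 * lam * (real j - 1)"
  using assms(2,3)
proof (induction j rule: nat_induct_at_least)
  case base
  have G: "minorant (model T 1)"
    by (rule minorant_linearization[OF w0_dom pdcp_first_model[OF run]])
  have w: "prox_argmin (model T 1) (iter T 1)" and c: "cand T 1 = iter T 1"
    using pdcp_iteration[OF run, of 1] by simp_all
  have wd: "iter T 1 \<in> edom n h" by (rule model_growth(1)[OF G w])
  have "model T 1 (iter T 1) = linearization n g g' w0 (iter T 1)"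
    by (rule pdcp_first_model[OF run dom_Rn[OF wd]])
  then have model: "real_of_ereal (model T 1 (iter T 1)) =
      g_real w0 + inner_n n (g' w0) (\<lambda>i. iter T 1 i - w0 i)"
    using linearization_dom[OF w0_dom] by simp
  have "objective (cand T 1) - model_value (model T 1) (iter T 1)
      \<le> 2 * M * dist_n n (iter T 1) w0"
    using linearization_error[OF wd w0_dom] unfolding objective_def model_value_def c model by linarith
  also have "\<dots> \<le> 2 * M * D"
    using diameter[OF wd w0_dom] M_pos by (intro mult_left_mono) auto
  finally show ?case using G w wd c by simp
next
  case (Suc j)
  define gap where "gap i = objective (cand T i) - model_value (model T i) (iter T i)" for i
  have IH: "minorant (model T j)" "prox_argmin (model T j) (iter T j)" "cand T j \<in> edom n h"
    "real j * (real j + 1) * gap j \<le> 4 * M * D + 16 * M\<^sup>2 * lam * (real j - 1)"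
    using Suc by (auto simp: gap_def)
  have jpos: "real j \<ge> 1" using \<open>j \<ge> 1\<close> by simp
  have t: "0 < weight j" "weight j \<le> 1" using jpos by auto
  have upd: "pdcp_update n g g' h w0 lam (weight j) (iter T j) (model T j) (model T (Suc j))"
    using pdcp_iteration(5)[OF run \<open>j \<ge> 1\<close>] Suc.prems \<open>j \<ge> 1\<close> by simp
  have "Suc j \<ge> 2" "Suc j \<ge> 1" using \<open>j \<ge> 1\<close> by auto
  then have next_step: "prox_argmin (model T (Suc j)) (iter T (Suc j))" "cand T (Suc j) \<in> Rn n"
     "g (cand T (Suc j)) + prox_term n h w0 lam (cand T (Suc j))
       \<le> ereal (weight j) * (g (cand T j) + prox_term n h w0 lam (cand T j))
         + ereal (1 - weight j) * (g (iter T (Suc j)) + prox_term n h w0 lam (iter T (Suc j)))"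
    using pdcp_iteration(1,2,4)[OF run \<open>Suc j \<ge> 1\<close> Suc.prems] \<open>Suc j \<ge> 2\<close> by simp_all
  note step = pdcp_gap_recursion[OF IH(1,2,3) t upd next_step]
  have "2 * M\<^sup>2 * lam * (1 - weight j)\<^sup>2 / weight j = 8 * M\<^sup>2 * lam / (real j * (real j + 2))"
    using jpos by (simp add: divide_simps power2_eq_square)
  then have rec: "gap (Suc j) \<le> weight j * gap j + 8 * M\<^sup>2 * lam / (real j * (real j + 2))"
    using step(3) by (simp add: gap_def)
  have "(real j + 1) * (real j + 2) * gap (Suc j)
      \<le> (real j + 1) * (real j + 2) * (weight j * gap j + 8 * M\<^sup>2 * lam / (real j * (real j + 2)))"
    by (intro mult_left_mono rec) auto
  also have "\<dots> = real j * (real j + 1) * gap j + 8 * M\<^sup>2 * lam * ((real j + 1) / real j)"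
    using jpos by (simp add: divide_simps) (simp add: algebra_simps)
  also have "8 * M\<^sup>2 * lam * ((real j + 1) / real j) \<le> 8 * M\<^sup>2 * lam * 2"
    using jpos lam_pos by (intro mult_left_mono) (auto simp: field_simps)
  finally have "(real j + 1) * (real j + 2) * gap (Suc j) \<le> 4 * M * D + 16 * M\<^sup>2 * lam * real j"
    using IH(4) by (simp add: algebra_simps)
  then show ?case using step(1,2) next_step(1) by (simp add: gap_def add.commute)
qed

text \<open>
  The bound is chosen so that \<open>N \<ge> a + 2 s\<close> with \<open>a = 16 M\<^sup>2 lam / eps\<close> and \<open>s\<^sup>2 = M D / eps\<close>. Then
  \<open>N\<^sup>2 \<ge> a N + 2 s N \<ge> a N + 4 s\<^sup>2\<close>, which contradicts the invariant if the gap exceeds \<open>eps\<close> up to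
  iteration \<open>N\<close>.
\<close>

lemma pdcp_stops:
  assumes run: "pdcp_run n g g' h weight w0 lam eps T" and "eps > 0" and "D > 0"
  shows "\<exists>N. pdcp_stops_at n g h w0 lam eps T N \<and>
    real N \<le> 16 * M\<^sup>2 * lam / eps + 2 * sqrt (M * D / eps) + 1"
proof -
  define a where "a = 16 * M\<^sup>2 * lam / eps"
  define s where "s = sqrt (M * D / eps)"
  define N where "N = nat \<lceil>a + 2 * s\<rceil>"
  have a: "a \<ge> 0" and s: "s > 0"
    using M_pos lam_pos \<open>eps > 0\<close> \<open>D > 0\<close> by (auto simp: a_def s_def)
  have s2: "s * s = M * D / eps"
    using M_pos \<open>eps > 0\<close> \<open>D > 0\<close> by (simp add: s_def)
  have N: "a + 2 * s \<le> real N" "real N \<le> a + 2 * s + 1"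
    using a s unfolding N_def by linarith+
  have "N \<ge> 1" using a s N(1) by (cases N) auto
  have "\<exists>j\<in>{1..N}. pdcp_gap n g h w0 lam T j \<le> ereal eps"
  proof (rule ccontr)
    assume "\<not> ?thesis"
    then have all: "\<forall>i\<in>{1..N}. pdcp_gap n g h w0 lam T i > ereal eps" by (auto simp: not_le)
    define gap where "gap = objective (cand T N) - model_value (model T N) (iter T N)"
    have inv: "minorant (model T N)" "prox_argmin (model T N) (iter T N)" "cand T N \<in> edom n h"
      "real N * (real N + 1) * gap \<le> 4 * M * D + 16 * M\<^sup>2 * lam * (real N - 1)"
      using pdcp_invariant[OF run \<open>N \<ge> 1\<close>] all by (auto simp: gap_def)
    have "gap > eps"
      using bspec[OF all, of N] \<open>N \<ge> 1\<close> pdcp_gap_dom[OF inv(1) model_growth(1)[OF inv(1,2)] inv(3)]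
      by (simp add: gap_def)
    then have "real N * (real N + 1) * eps < real N * (real N + 1) * gap"
      using \<open>N \<ge> 1\<close> by (intro mult_strict_left_mono) auto
    also have "\<dots> \<le> 4 * (M * D) + 16 * M\<^sup>2 * lam * (real N - 1)"
      using inv(4) by (simp only: mult.assoc)
    also have "\<dots> = eps * (4 * (s * s) + a * (real N - 1))"
      using \<open>eps > 0\<close> by (simp add: s2 a_def distrib_left)
    finally have "real N * (real N + 1) < 4 * (s * s) + a * (real N - 1)"
      using \<open>eps > 0\<close> by (simp add: mult.commute)
    moreover have "(a + 2 * s) * real N \<le> real N * real N" using N(1) by (intro mult_right_mono) auto
    moreover have "2 * s * (2 * s) \<le> 2 * s * real N" using N(1) a s by (intro mult_left_mono) auto
    ultimately show False using a by (simp add: algebra_simps)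
  qed
  then obtain j where j: "j \<in> {1..N}" "pdcp_gap n g h w0 lam T j \<le> ereal eps" by blast
  define J where "J = (LEAST j. j \<ge> 1 \<and> pdcp_gap n g h w0 lam T j \<le> ereal eps)"
  have J: "J \<ge> 1 \<and> pdcp_gap n g h w0 lam T J \<le> ereal eps"
    unfolding J_def by (rule LeastI[of _ j]) (use j in auto)
  have min: "pdcp_gap n g h w0 lam T i > ereal eps" if "i \<ge> 1" "i < J" for i
    using not_less_Least[OF that(2)[unfolded J_def]] that(1) by simp
  have "J \<le> j" unfolding J_def by (rule Least_le) (use j in auto)
  show ?thesis
  proof (intro exI[of _ J] conjI)
    show "pdcp_stops_at n g h w0 lam eps T J"
      using J min by (simp add: pdcp_stops_at_def)
    show "real J \<le> 16 * M\<^sup>2 * lam / eps + 2 * sqrt (M * D / eps) + 1"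
      using \<open>J \<le> j\<close> j(1) N(2) by (simp add: a_def s_def)
  qed
qed

text \<open>
  All the outer iteration needs from a call: the model minimum bounds every objective value from
  below with quadratic growth, and the candidate is within \<open>eps\<close> of that minimum.
\<close>

lemma pdcp_output:
  assumes run: "pdcp_run n g g' h weight w0 lam eps T"
    and stop: "pdcp_stops_at n g h w0 lam eps T N"
  shows "iter T N \<in> edom n h" and "cand T N \<in> edom n h"
    and "u \<in> edom n h \<Longrightarrow>
      objective (cand T N) + (dist_n n u (iter T N))\<^sup>2 / (2 * lam) \<le> objective u + eps"
proof -
  have N: "N \<ge> 1" "\<forall>i\<in>{1..<N}. pdcp_gap n g h w0 lam T i > ereal eps"
    and gap: "pdcp_gap n g h w0 lam T N \<le> ereal eps"
    using stop by (auto simp: pdcp_stops_at_def)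
  have inv: "minorant (model T N)" "prox_argmin (model T N) (iter T N)" "cand T N \<in> edom n h"
    using pdcp_invariant[OF run N] by auto
  show wd: "iter T N \<in> edom n h" by (rule model_growth(1)[OF inv(1,2)])
  show "cand T N \<in> edom n h" by fact
  show "objective (cand T N) + (dist_n n u (iter T N))\<^sup>2 / (2 * lam) \<le> objective u + eps"
    if u: "u \<in> edom n h"
    using gap pdcp_gap_dom[OF inv(1) wd inv(3)] model_growth(2)[OF inv(1,2) u]
      model_value_le_objective[OF inv(1) u] by simp
qed

end

section \<open>The outer iteration\<close>

text \<open>
  The induction step \<open>1 / b \<le> 2 (b - a)\<close>, for \<open>a = sqrt K\<close> and \<open>b = sqrt (K + 1)\<close>, is
  \<open>0 \<le> (b - a)\<^sup>2\<close> in view of \<open>b\<^sup>2 = a\<^sup>2 + 1\<close>.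
\<close>

lemma sum_inverse_sqrt_le: "(\<Sum>k = 1..K. 1 / sqrt (real k)) \<le> 2 * sqrt (real K)"
proof (induction K)
  case (Suc K)
  define a b where "a = sqrt (real K)" and "b = sqrt (real (Suc K))"
  have a: "0 \<le> a" "a \<le> b" and b: "b > 0" and eq: "b * b = a * a + 1"
    by (simp_all add: a_def b_def)
  have "0 \<le> (b - a)\<^sup>2" by simp
  then have "1 \<le> (2 * b - 2 * a) * b"
    using eq by (simp add: power2_eq_square algebra_simps)
  then have "1 / b \<le> 2 * b - 2 * a" using b by (simp add: pos_divide_le_eq)
  then show ?case using Suc by (simp add: a_def b_def)
qed simp

text \<open>
  Increasing weights destroy the telescoping, but for bounded \<open>d\<close> only up to the last weight. Keeping
  the term \<open>d K\<close> on the right is what makes the induction go through.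
\<close>

lemma weighted_telescope_le:
  fixes c d :: "nat \<Rightarrow> real"
  assumes "mono c" "c 0 \<ge> 0" "\<And>k. d k \<le> A"
  shows "(\<Sum>k = 1..K. c k * (d (k - 1) - d k)) \<le> c K * (A - d K)"
proof (induction K)
  case 0
  then show ?case using assms(2) assms(3)[of 0] by simp
next
  case (Suc K)
  have "c K * (A - d K) \<le> c (Suc K) * (A - d K)"
    using assms(3)[of K] monoD[OF assms(1), of K "Suc K"] by (intro mult_right_mono) auto
  then show ?case using Suc by (simp add: algebra_simps)
qed

locale bounded_spp =
  fixes P :: spp and M D :: real
  assumes assumptions: "spp_assumptions P M D"
begin

abbreviation "dist1 \<equiv> dist_n (dim_x P)"
abbreviation "dist2 \<equiv> dist_n (dim_y P)"

definition f_real :: "rvec \<Rightarrow> rvec \<Rightarrow> real" where "f_real x y = real_of_ereal (spp_f P x y)"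
definition h1_real :: "rvec \<Rightarrow> real" where "h1_real x = real_of_ereal (spp_h1 P x)"
definition h2_real :: "rvec \<Rightarrow> real" where "h2_real y = real_of_ereal (spp_h2 P y)"

lemma f_convex: "\<forall>y\<in>Rn (dim_y P). convex_fun (dim_x P) (\<lambda>x. spp_f P x y)"
  and f_concave: "\<forall>x\<in>Rn (dim_x P). convex_fun (dim_y P) (\<lambda>y. - spp_f P x y)"
  and h1_proper_lsc_convex: "proper_lsc_convex (dim_x P) (spp_h1 P)"
  and h2_proper_lsc_convex: "proper_lsc_convex (dim_y P) (spp_h2 P)"
  and f_not_infinite: "\<forall>x\<in>dom1 P. \<forall>y\<in>dom2 P. \<bar>spp_f P x y\<bar> \<noteq> \<infinity>"
  and oracles: "\<forall>u\<in>dom1 P. \<forall>v\<in>dom2 P.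
        is_subgradient (dim_x P) (\<lambda>x. spp_f P x v) u (spp_fx P u v) \<and>
        is_supergradient (dim_y P) (\<lambda>y. spp_f P u y) v (spp_fy P u v)"
  and M_pos: "M > 0"
  and oracle_bounds: "\<forall>u\<in>dom1 P. \<forall>v\<in>dom2 P.
        norm_n (dim_x P) (spp_fx P u v) \<le> M \<and> norm_n (dim_y P) (spp_fy P u v) \<le> M"
  and bdd_dom_distances: "bdd_above (dom_distances P)"
  and D_eq: "D = Sup (dom_distances P)"
  and D_pos: "D > 0"
  and saddle_point: "\<exists>x y. is_saddle_point P x y"
  by (insert assumptions, unfold spp_assumptions_def) (elim conjE, assumption)+

lemma h1_facts: "convex_fun (dim_x P) (spp_h1 P)" "\<And>u. u \<in> Rn (dim_x P) \<Longrightarrow> spp_h1 P u \<noteq> - \<infinity>"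
  and h2_facts: "convex_fun (dim_y P) (spp_h2 P)" "\<And>u. u \<in> Rn (dim_y P) \<Longrightarrow> spp_h2 P u \<noteq> - \<infinity>"
  using h1_proper_lsc_convex h2_proper_lsc_convex
  by (simp_all add: proper_lsc_convex_def proper_fun_def)

lemma f_finite: "x \<in> dom1 P \<Longrightarrow> y \<in> dom2 P \<Longrightarrow> spp_f P x y = ereal (f_real x y)"
  using f_not_infinite by (simp add: f_real_def ereal_real)

lemma h1_finite: "x \<in> dom1 P \<Longrightarrow> spp_h1 P x = ereal (h1_real x)"
  using h1_facts(2)[of x] by (cases "spp_h1 P x") (auto simp: h1_real_def dom1_def edom_def)

lemma h2_finite: "y \<in> dom2 P \<Longrightarrow> spp_h2 P y = ereal (h2_real y)"
  using h2_facts(2)[of y] by (cases "spp_h2 P y") (auto simp: h2_real_def dom2_def edom_def)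

lemma dom_nonempty: "\<exists>x. x \<in> dom1 P" "\<exists>y. y \<in> dom2 P"
  using saddle_point unfolding is_saddle_point_def by blast+

lemma joint_diameter:
  assumes "x \<in> dom1 P" "y \<in> dom2 P" "u \<in> dom1 P" "v \<in> dom2 P"
  shows "(dist1 x u)\<^sup>2 + (dist2 y v)\<^sup>2 \<le> D\<^sup>2"
proof -
  have "sqrt ((dist1 x u)\<^sup>2 + (dist2 y v)\<^sup>2) \<in> dom_distances P"
    unfolding dom_distances_def using assms by blast
  then have "sqrt ((dist1 x u)\<^sup>2 + (dist2 y v)\<^sup>2) \<le> D"
    by (rule cSup_upper[OF _ bdd_dom_distances, folded D_eq])
  then show ?thesis by (rule sqrt_le_D)
qed

lemma diameter1:
  assumes "x \<in> dom1 P" "u \<in> dom1 P"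
  shows "dist1 x u \<le> D"
proof -
  obtain y where y: "y \<in> dom2 P" using dom_nonempty(2) by blast
  have "(dist1 x u)\<^sup>2 \<le> D\<^sup>2"
    using joint_diameter[OF assms(1) y assms(2) y] zero_le_power2[of "dist2 y y"] by linarith
  then show ?thesis using less_imp_le[OF D_pos] by (rule power2_le_imp_le)
qed

lemma diameter2:
  assumes "y \<in> dom2 P" "v \<in> dom2 P"
  shows "dist2 y v \<le> D"
proof -
  obtain x where x: "x \<in> dom1 P" using dom_nonempty(1) by blast
  have "(dist2 y v)\<^sup>2 \<le> D\<^sup>2"
    using joint_diameter[OF x assms(1) x assms(2)] zero_le_power2[of "dist1 x x"] by linarith
  then show ?thesis using less_imp_le[OF D_pos] by (rule power2_le_imp_le)
qed

lemma x_subproblem: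
  assumes "x \<in> dom1 P" "y \<in> dom2 P" "lam > 0"
  shows "bounded_prox_problem (dim_x P) (\<lambda>u. spp_f P u y) (\<lambda>u. spp_fx P u y) (spp_h1 P) x lam M D"
proof unfold_locales
  show "\<bar>spp_f P u y\<bar> \<noteq> \<infinity>" if "u \<in> edom (dim_x P) (spp_h1 P)" for u
    using f_finite[OF _ assms(2)] that by (simp add: dom1_def)
qed (use assms oracles oracle_bounds h1_facts diameter1 M_pos in \<open>simp_all add: dom1_def\<close>)

text \<open>
  The \<open>y\<close>-call minimizes the negative of \<open>f\<close>, so supergradients turn into subgradients with the
  opposite sign.
\<close>

lemma y_subproblem:
  assumes "x \<in> dom1 P" "y \<in> dom2 P" "lam > 0"
  shows "bounded_prox_problem (dim_y P) (\<lambda>v. - spp_f P x v) (\<lambda>v i. - spp_fy P x v i)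
    (spp_h2 P) y lam M D"
proof -
  have neg_subgradient: "is_subgradient n (\<lambda>v. - F v) u (\<lambda>i. - s i)"
    if "is_supergradient n F u s" "F u = ereal r" for n F u s r
    unfolding is_subgradient_def
  proof (intro conjI ballI)
    show "(\<lambda>i. - s i) \<in> Rn n"
      using that(1) by (simp add: is_supergradient_def mem_Rn_iff)
    fix v assume "v \<in> Rn n"
    then have "F v \<le> ereal (r + inner_n n s (\<lambda>i. v i - u i))"
      using that by (simp add: is_supergradient_def)
    then show "- F u + ereal (inner_n n (\<lambda>i. - s i) (\<lambda>i. v i - u i)) \<le> - F v"
      using that(2) by (cases "F v") (simp_all add: inner_n_def sum_negf)
  qed
  have "is_subgradient (dim_y P) (\<lambda>v. - spp_f P x v) u (\<lambda>i. - spp_fy P x u i)" if "u \<in> dom2 P" for u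
    by (rule neg_subgradient[where F = "\<lambda>v. spp_f P x v", OF _ f_finite[OF assms(1) that]])
      (use oracles assms(1) that in blast)
  moreover have "norm_n (dim_y P) (\<lambda>i. - spp_fy P x u i) \<le> M" if "u \<in> dom2 P" for u
    using oracle_bounds assms(1) that by (simp add: norm_n_def L2_set_def)
  moreover have "\<bar>- spp_f P x v\<bar> \<noteq> \<infinity>" if "v \<in> dom2 P" for v
    using f_finite[OF assms(1) that] by simp
  ultimately show ?thesis
    using assms h2_facts diameter2 M_pos
    by unfold_locales (simp_all add: dom2_def)
qed

lemma f_lipschitz_x:
  assumes "x \<in> dom1 P" "u \<in> dom1 P" "y \<in> dom2 P"
  shows "f_real x y - f_real u y \<le> M * dist1 x u"
proof -
  interpret X: bounded_prox_problem "dim_x P" "\<lambda>u. spp_f P u y" "\<lambda>u. spp_fx P u y" "spp_h1 P" x 1 M D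
    by (rule x_subproblem) (use assms in auto)
  show ?thesis using X.g_real_lipschitz[of x u] assms by (simp add: X.g_real_def f_real_def dom1_def)
qed

lemma f_lipschitz_y:
  assumes "x \<in> dom1 P" "y \<in> dom2 P" "v \<in> dom2 P"
  shows "f_real x y - f_real x v \<le> M * dist2 y v"
proof -
  interpret Y: bounded_prox_problem "dim_y P" "\<lambda>v. - spp_f P x v" "\<lambda>v i. - spp_fy P x v i" "spp_h2 P"
      y 1 M D
    by (rule y_subproblem) (use assms in auto)
  show ?thesis using Y.g_real_lipschitz[of v y] assms dist_n_commute[of _ y v]
    by (simp add: Y.g_real_def f_real_def dom2_def)
qed

text \<open>
  The real value of \<open>\<phi>(x, v) - \<phi>(u, y)\<close>, which an \<open>eps\<close>-saddle-point keeps below \<open>eps\<close>.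
\<close>

definition gap_term :: "rvec \<Rightarrow> rvec \<Rightarrow> rvec \<Rightarrow> rvec \<Rightarrow> real" where
  "gap_term u v x y =
     (f_real x v + h1_real x - h2_real v) - (f_real u y + h1_real u - h2_real y)"

lemma x_call_output:
  assumes x: "x \<in> dom1 P" and y: "y \<in> dom2 P" and lam: "lam > 0"
    and run: "pdcp_run (dim_x P) (\<lambda>u. spp_f P u y) (\<lambda>u. spp_fx P u y) (spp_h1 P)
      (\<lambda>j. real j / (real j + 2)) x lam eps T"
    and stop: "pdcp_stops_at (dim_x P) (\<lambda>u. spp_f P u y) (spp_h1 P) x lam eps T N"
  shows "iter T N \<in> dom1 P" "cand T N \<in> dom1 P"
    and "u \<in> dom1 P \<Longrightarrow>
      f_real (cand T N) y + h1_real (cand T N) + (dist1 (cand T N) x)\<^sup>2 / (2 * lam)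
        + (dist1 u (iter T N))\<^sup>2 / (2 * lam)
      \<le> f_real u y + h1_real u + (dist1 u x)\<^sup>2 / (2 * lam) + eps"
proof -
  interpret X: bounded_prox_problem "dim_x P" "\<lambda>u. spp_f P u y" "\<lambda>u. spp_fx P u y" "spp_h1 P" x lam M D
    by (rule x_subproblem[OF x y lam])
  note out = X.pdcp_output[OF run stop]
  show "iter T N \<in> dom1 P" "cand T N \<in> dom1 P" using out(1,2) by (simp_all add: dom1_def)
  show "f_real (cand T N) y + h1_real (cand T N) + (dist1 (cand T N) x)\<^sup>2 / (2 * lam)
        + (dist1 u (iter T N))\<^sup>2 / (2 * lam)
      \<le> f_real u y + h1_real u + (dist1 u x)\<^sup>2 / (2 * lam) + eps" if "u \<in> dom1 P"
    using out(3)[of u] that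
    by (simp add: X.objective_def X.g_real_def X.h_real_def X.prox_sq_def f_real_def h1_real_def dom1_def)
qed

lemma y_call_output:
  assumes x: "x \<in> dom1 P" and y: "y \<in> dom2 P" and lam: "lam > 0"
    and run: "pdcp_run (dim_y P) (\<lambda>v. - spp_f P x v) (\<lambda>v i. - spp_fy P x v i) (spp_h2 P)
      (\<lambda>j. real j / (real j + 2)) y lam eps T"
    and stop: "pdcp_stops_at (dim_y P) (\<lambda>v. - spp_f P x v) (spp_h2 P) y lam eps T N"
  shows "iter T N \<in> dom2 P" "cand T N \<in> dom2 P"
    and "v \<in> dom2 P \<Longrightarrow>
      - f_real x (cand T N) + h2_real (cand T N) + (dist2 (cand T N) y)\<^sup>2 / (2 * lam)
        + (dist2 v (iter T N))\<^sup>2 / (2 * lam)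
      \<le> - f_real x v + h2_real v + (dist2 v y)\<^sup>2 / (2 * lam) + eps"
proof -
  interpret Y: bounded_prox_problem "dim_y P" "\<lambda>v. - spp_f P x v" "\<lambda>v i. - spp_fy P x v i" "spp_h2 P"
      y lam M D
    by (rule y_subproblem[OF x y lam])
  note out = Y.pdcp_output[OF run stop]
  show "iter T N \<in> dom2 P" "cand T N \<in> dom2 P" using out(1,2) by (simp_all add: dom2_def)
  show "- f_real x (cand T N) + h2_real (cand T N) + (dist2 (cand T N) y)\<^sup>2 / (2 * lam)
        + (dist2 v (iter T N))\<^sup>2 / (2 * lam)
      \<le> - f_real x v + h2_real v + (dist2 v y)\<^sup>2 / (2 * lam) + eps" if "v \<in> dom2 P"
    using out(3)[of v] that
    by (simp add: Y.objective_def Y.g_real_def Y.h_real_def Y.prox_sq_def f_real_def h2_real_def dom2_def)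
qed

text \<open>
  One outer iteration, from \<open>(x, y)\<close> to \<open>(x1, y1)\<close> with candidates \<open>(xt, yt)\<close>. The hypotheses involve
  \<open>f xt y - f x yt + f x v - f u y\<close>, where the claim involves \<open>f xt v - f u yt\<close>. The difference splits
  into two increments of \<open>f\<close> between \<open>x\<close> and \<open>xt\<close> and two between \<open>y\<close> and \<open>yt\<close>, hence is at most
  \<open>2 M a + 2 M b\<close> for the step lengths \<open>a\<close> and \<open>b\<close>. The two proximal terms on the left of the
  hypotheses absorb this.
\<close>

lemma gap_term_le:
  assumes dom: "x \<in> dom1 P" "xt \<in> dom1 P" "u \<in> dom1 P" "y \<in> dom2 P" "yt \<in> dom2 P" "v \<in> dom2 P"
    and lam: "lam > 0"
    and X: "f_real xt y + h1_real xt + (dist1 xt x)\<^sup>2 / (2 * lam) + (dist1 u x1)\<^sup>2 / (2 * lam)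
      \<le> f_real u y + h1_real u + (dist1 u x)\<^sup>2 / (2 * lam) + e"
    and Y: "- f_real x yt + h2_real yt + (dist2 yt y)\<^sup>2 / (2 * lam) + (dist2 v y1)\<^sup>2 / (2 * lam)
      \<le> - f_real x v + h2_real v + (dist2 v y)\<^sup>2 / (2 * lam) + e"
  shows "gap_term u v xt yt \<le> 2 * e + 4 * M\<^sup>2 * lam
    + (((dist1 u x)\<^sup>2 + (dist2 v y)\<^sup>2) - ((dist1 u x1)\<^sup>2 + (dist2 v y1)\<^sup>2)) / (2 * lam)"
proof -
  define a b where "a = dist1 xt x" and "b = dist2 yt y"
  have absorb: "2 * M * d - d\<^sup>2 / (2 * lam) \<le> 2 * M\<^sup>2 * lam" for d
  proof -
    have "2 * M * d - 1 / (2 * lam) * d\<^sup>2 \<le> (2 * M)\<^sup>2 / (4 * (1 / (2 * lam)))"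
      using lam by (intro quadratic_absorbs_linear) simp
    then show ?thesis by (simp add: power2_eq_square)
  qed
  have "f_real xt v - f_real x v \<le> M * a" "f_real x y - f_real xt y \<le> M * a"
    using f_lipschitz_x[OF dom(2,1,6)] f_lipschitz_x[OF dom(1,2,4)]
    unfolding a_def dist_n_commute[of _ x xt] .
  moreover have "f_real u y - f_real u yt \<le> M * b" "f_real x yt - f_real x y \<le> M * b"
    using f_lipschitz_y[OF dom(3,4,5)] f_lipschitz_y[OF dom(1,5,4)]
    unfolding b_def dist_n_commute[of _ y yt] .
  ultimately show ?thesis
    using X Y absorb[of a] absorb[of b]
    unfolding gap_term_def a_def[symmetric] b_def[symmetric]
    by (simp add: add_divide_distrib diff_divide_distrib)
qed

text \<open>
  By convexity in \<open>x\<close> and concavity in \<open>y\<close>, the gap at the averaged pair is at most the average gap.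
\<close>

lemma average_eps_saddle_point:
  assumes "K \<ge> 1" and dom: "\<And>k. k \<in> {1..K} \<Longrightarrow> xt k \<in> dom1 P \<and> yt k \<in> dom2 P"
    and gap: "\<And>u v. u \<in> dom1 P \<Longrightarrow> v \<in> dom2 P \<Longrightarrow>
      (\<Sum>k = 1..K. gap_term u v (xt k) (yt k)) / real K \<le> eps"
  shows "is_eps_saddle_point P eps (average K xt) (average K yt)"
proof -
  let ?x = "average K xt" and ?y = "average K yt"
  have Rx: "xt k \<in> Rn (dim_x P)" and Ry: "yt k \<in> Rn (dim_y P)" if "k \<in> {1..K}" for k
    using dom[OF that] by (simp_all add: dom1_def dom2_def edom_def)
  have hx: "?x \<in> Rn (dim_x P) \<and> spp_h1 P ?x \<le> ereal ((\<Sum>k = 1..K. h1_real (xt k)) / real K)"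
    by (rule convex_fun_average[OF h1_facts(1) \<open>K \<ge> 1\<close>]) (use Rx dom h1_finite in auto)
  have hy: "?y \<in> Rn (dim_y P) \<and> spp_h2 P ?y \<le> ereal ((\<Sum>k = 1..K. h2_real (yt k)) / real K)"
    by (rule convex_fun_average[OF h2_facts(1) \<open>K \<ge> 1\<close>]) (use Ry dom h2_finite in auto)
  have xd: "?x \<in> dom1 P" using hx by (auto simp: dom1_def edom_def)
  have yd: "?y \<in> dom2 P" using hy by (auto simp: dom2_def edom_def)
  have "spp_phi P ?x v - spp_phi P u ?y \<le> ereal eps" if u: "u \<in> dom1 P" and v: "v \<in> dom2 P" for u v
  proof -
    have cx: "convex_fun (dim_x P) (\<lambda>x. spp_f P x v)" and cy: "convex_fun (dim_y P) (\<lambda>y. - spp_f P u y)"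
      using f_convex f_concave u v by (simp_all add: dom1_def dom2_def edom_def)
    have "spp_f P ?x v \<le> ereal ((\<Sum>k = 1..K. f_real (xt k) v) / real K)"
      using convex_fun_average[OF cx \<open>K \<ge> 1\<close>, of xt "\<lambda>k. f_real (xt k) v"] Rx dom f_finite v by simp
    moreover have "- spp_f P u ?y \<le> ereal ((\<Sum>k = 1..K. - f_real u (yt k)) / real K)"
      using convex_fun_average[OF cy \<open>K \<ge> 1\<close>, of yt "\<lambda>k. - f_real u (yt k)"] Ry dom f_finite u by simp
    ultimately have "gap_term u v ?x ?y \<le>
        (\<Sum>k = 1..K. f_real (xt k) v) / real K + (\<Sum>k = 1..K. h1_real (xt k)) / real K
        + (\<Sum>k = 1..K. - f_real u (yt k)) / real K + (\<Sum>k = 1..K. h2_real (yt k)) / real K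
        - h1_real u - h2_real v"
      using hx hy xd yd u v by (simp add: f_finite h1_finite h2_finite gap_term_def)
    also have "\<dots> = (\<Sum>k = 1..K. gap_term u v (xt k) (yt k)) / real K"
      using \<open>K \<ge> 1\<close>
      by (simp add: gap_term_def sum.distrib sum_subtractf sum_negf add_divide_distrib diff_divide_distrib)
    also have "\<dots> \<le> eps" by (rule gap[OF u v])
    finally show ?thesis
      using xd yd u v by (simp add: spp_phi_def f_finite h1_finite h2_finite gap_term_def)
  qed
  then show ?thesis using xd yd by (simp add: is_eps_saddle_point_def)
qed

text \<open>
  The bound of \<open>pdcp_stops\<close> for tolerance \<open>eps / 4\<close> and stepsize \<open>\<lambda>\<^sub>k\<close>.
\<close>

definition call_bound :: "real \<Rightarrow> nat \<Rightarrow> real" where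
  "call_bound eps k = 16 * (M * D / eps) / sqrt (real k) + 4 * sqrt (M * D / eps) + 1"

context
  fixes lam :: "nat \<Rightarrow> real" and eps :: real and x0 y0 :: rvec and R :: pbspp_trace
  assumes eps: "eps > 0" and x0: "x0 \<in> dom1 P" and y0: "y0 \<in> dom2 P"
    and lam1: "lam 1 = D / (4 * M)" and lamk: "\<forall>k\<ge>1. lam k = lam 1 / sqrt (real k)"
    and run: "pbspp_run P (\<lambda>j. real j / (real j + 2)) lam eps x0 y0 R"
begin

lemma lam_eq: "k \<ge> 1 \<Longrightarrow> lam k = D / (4 * M * sqrt (real k))"
  using lamk[THEN spec, of k, THEN mp] unfolding lam1 by simp

lemma lam_pos: "k \<ge> 1 \<Longrightarrow> lam k > 0"
  using lam_eq[of k] M_pos D_pos by simp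

lemma call_bound_eq:
  "k \<ge> 1 \<Longrightarrow> 16 * M\<^sup>2 * lam k / (eps / 4) + 2 * sqrt (M * D / (eps / 4)) + 1 = call_bound eps k"
proof -
  assume k: "k \<ge> 1"
  have four: "M * D / (eps / 4) = 4 * (M * D / eps)" by simp
  have "sqrt (M * D / (eps / 4)) = 2 * sqrt (M * D / eps)"
    unfolding four real_sqrt_mult by simp
  moreover have "16 * M\<^sup>2 * lam k / (eps / 4) = 16 * (M * D / eps) / sqrt (real k)"
    using M_pos by (simp add: lam_eq[OF k] power2_eq_square mult.commute)
  ultimately show ?thesis by (simp add: call_bound_def)
qed

text \<open>
  An outer iteration is constrained only if all earlier calls have stopped, so termination of the
  calls and membership of the iterates in the domains are established by a joint induction.
\<close>

lemma outer_invariant: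
  "seq_x R k \<in> dom1 P \<and> seq_y R k \<in> dom2 P \<and>
   (k \<ge> 1 \<longrightarrow> x_call_run P (\<lambda>j. real j / (real j + 2)) lam eps R k \<and>
     y_call_run P (\<lambda>j. real j / (real j + 2)) lam eps R k \<and>
     (\<exists>N. x_call_stops_at P lam eps R k N \<and> real N \<le> call_bound eps k \<and>
       seq_x R k = iter (call_x R k) N \<and> seq_xt R k = cand (call_x R k) N) \<and>
     (\<exists>N. y_call_stops_at P lam eps R k N \<and> real N \<le> call_bound eps k \<and>
       seq_y R k = iter (call_y R k) N \<and> seq_yt R k = cand (call_y R k) N))"
proof (induction k rule: less_induct)
  case (less k)
  show ?case
  proof (cases "k = 0")
    case True
    then show ?thesis using run x0 y0 by (simp add: pbspp_run_def)
  next
    case False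
    then have k: "k \<ge> 1" by simp
    have prev: "seq_x R (k - 1) \<in> dom1 P" "seq_y R (k - 1) \<in> dom2 P"
      using less[of "k - 1"] k by auto
    have earlier: "\<forall>i\<in>{1..<k}. (\<exists>N. x_call_stops_at P lam eps R i N) \<and>
        (\<exists>N. y_call_stops_at P lam eps R i N)"
    proof
      fix i assume "i \<in> {1..<k}"
      then have i: "i < k" "i \<ge> 1" by simp_all
      note IH = less[OF i(1), THEN conjunct2, THEN conjunct2, THEN mp, OF i(2), THEN conjunct2,
          THEN conjunct2]
      show "(\<exists>N. x_call_stops_at P lam eps R i N) \<and> (\<exists>N. y_call_stops_at P lam eps R i N)"
        using IH by fast
    qed
    note now = run[unfolded pbspp_run_def, THEN conjunct2, THEN conjunct2, THEN spec, THEN mp, OF k,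
        THEN mp, OF earlier]
    note runs = now[THEN conjunct1] now[THEN conjunct2, THEN conjunct1]
    note res = now[THEN conjunct2, THEN conjunct2, THEN conjunct1, THEN spec, THEN mp]
      now[THEN conjunct2, THEN conjunct2, THEN conjunct2, THEN spec, THEN mp]
    note x_run = runs(1)[unfolded x_call_run_def] and y_run = runs(2)[unfolded y_call_run_def]
    have "eps / 4 > 0" using eps by simp
    have "\<exists>N. x_call_stops_at P lam eps R k N \<and> real N \<le> call_bound eps k"
      unfolding x_call_stops_at_def call_bound_eq[OF k, symmetric]
      by (rule bounded_prox_problem.pdcp_stops
          [OF x_subproblem[OF prev lam_pos[OF k]] x_run \<open>eps / 4 > 0\<close> D_pos])
    then obtain Nx where Nx: "x_call_stops_at P lam eps R k Nx" "real Nx \<le> call_bound eps k"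
      by (elim exE conjE)
    have "\<exists>N. y_call_stops_at P lam eps R k N \<and> real N \<le> call_bound eps k"
      unfolding y_call_stops_at_def call_bound_eq[OF k, symmetric]
      by (rule bounded_prox_problem.pdcp_stops
          [OF y_subproblem[OF prev lam_pos[OF k]] y_run \<open>eps / 4 > 0\<close> D_pos])
    then obtain Ny where Ny: "y_call_stops_at P lam eps R k Ny" "real Ny \<le> call_bound eps k"
      by (elim exE conjE)
    have "seq_x R k \<in> dom1 P" "seq_y R k \<in> dom2 P"
      using x_call_output(1)[OF prev lam_pos[OF k] x_run Nx(1)[unfolded x_call_stops_at_def]]
        y_call_output(1)[OF prev lam_pos[OF k] y_run Ny(1)[unfolded y_call_stops_at_def]]
        res(1)[OF Nx(1)] res(2)[OF Ny(1)] by simp_all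
    then show ?thesis using runs res(1)[OF Nx(1)] res(2)[OF Ny(1)] Nx Ny by blast
  qed
qed

lemma outer_step:
  assumes k: "k \<ge> 1"
  shows "seq_xt R k \<in> dom1 P" "seq_yt R k \<in> dom2 P"
    and "u \<in> dom1 P \<Longrightarrow> v \<in> dom2 P \<Longrightarrow>
      gap_term u v (seq_xt R k) (seq_yt R k) \<le> eps / 2 + 4 * M\<^sup>2 * lam k
        + (((dist1 u (seq_x R (k - 1)))\<^sup>2 + (dist2 v (seq_y R (k - 1)))\<^sup>2)
            - ((dist1 u (seq_x R k))\<^sup>2 + (dist2 v (seq_y R k))\<^sup>2)) / (2 * lam k)"
proof -
  have prev: "seq_x R (k - 1) \<in> dom1 P" "seq_y R (k - 1) \<in> dom2 P"
    using outer_invariant[of "k - 1"] by auto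
  obtain Nx Ny where stops: "x_call_stops_at P lam eps R k Nx" "y_call_stops_at P lam eps R k Ny"
    and res: "seq_x R k = iter (call_x R k) Nx" "seq_xt R k = cand (call_x R k) Nx"
      "seq_y R k = iter (call_y R k) Ny" "seq_yt R k = cand (call_y R k) Ny"
    and runs: "x_call_run P (\<lambda>j. real j / (real j + 2)) lam eps R k"
        "y_call_run P (\<lambda>j. real j / (real j + 2)) lam eps R k"
    using outer_invariant[of k] k by blast
  note X = x_call_output[OF prev lam_pos[OF k] runs(1)[unfolded x_call_run_def]
      stops(1)[unfolded x_call_stops_at_def], folded res]
  note Y = y_call_output[OF prev lam_pos[OF k] runs(2)[unfolded y_call_run_def]
      stops(2)[unfolded y_call_stops_at_def], folded res]
  show "seq_xt R k \<in> dom1 P" "seq_yt R k \<in> dom2 P" by (rule X(2), rule Y(2))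
  show "gap_term u v (seq_xt R k) (seq_yt R k) \<le> eps / 2 + 4 * M\<^sup>2 * lam k
        + (((dist1 u (seq_x R (k - 1)))\<^sup>2 + (dist2 v (seq_y R (k - 1)))\<^sup>2)
            - ((dist1 u (seq_x R k))\<^sup>2 + (dist2 v (seq_y R k))\<^sup>2)) / (2 * lam k)"
    if u: "u \<in> dom1 P" and v: "v \<in> dom2 P"
    using gap_term_le[OF prev(1) X(2) u prev(2) Y(2) v lam_pos[OF k] X(3)[OF u] Y(3)[OF v]] by simp
qed

text \<open>
  Since \<open>1 / \<lambda>\<^sub>k\<close> grows like \<open>sqrt k\<close>, the telescoping part of the sum contributes at most
  \<open>2 M D sqrt K\<close>, and the stepsizes sum to another \<open>2 M D sqrt K\<close>. The choice of \<open>\<lambda>\<^sub>1\<close> makes these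
  two contributions equal.
\<close>

lemma average_gap_le:
  assumes K: "K \<ge> 1" and u: "u \<in> dom1 P" and v: "v \<in> dom2 P"
  shows "(\<Sum>k = 1..K. gap_term u v (seq_xt R k) (seq_yt R k)) / real K
    \<le> eps / 2 + 4 * M * D / sqrt (real K)"
proof -
  define d where "d k = (dist1 u (seq_x R k))\<^sup>2 + (dist2 v (seq_y R k))\<^sup>2" for k
  have d: "0 \<le> d k" "d k \<le> D\<^sup>2" for k
    using joint_diameter[OF u v] outer_invariant[of k] by (simp_all add: d_def)
  have "(\<Sum>k = 1..K. gap_term u v (seq_xt R k) (seq_yt R k))
      \<le> (\<Sum>k = 1..K. eps / 2 + M * D * (1 / sqrt (real k))
            + 2 * M / D * (sqrt (real k) * (d (k - 1) - d k)))"
  proof (rule sum_mono)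
    fix k assume "k \<in> {1..K}"
    then have k: "k \<ge> 1" by simp
    have "4 * M\<^sup>2 * lam k = M * D * (1 / sqrt (real k))"
      using M_pos by (simp add: lam_eq[OF k] power2_eq_square)
    moreover have "(d (k - 1) - d k) / (2 * lam k) = 2 * M / D * (sqrt (real k) * (d (k - 1) - d k))"
      using M_pos D_pos k by (simp add: lam_eq[OF k])
    ultimately show "gap_term u v (seq_xt R k) (seq_yt R k) \<le> eps / 2 + M * D * (1 / sqrt (real k))
            + 2 * M / D * (sqrt (real k) * (d (k - 1) - d k))"
      using outer_step(3)[OF k u v] by (simp only: d_def[symmetric])
  qed
  also have "\<dots> = real K * (eps / 2) + M * D * (\<Sum>k = 1..K. 1 / sqrt (real k))
      + 2 * M / D * (\<Sum>k = 1..K. sqrt (real k) * (d (k - 1) - d k))"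
    by (simp add: sum.distrib sum_distrib_left)
  also have "\<dots> \<le> real K * (eps / 2) + M * D * (2 * sqrt (real K)) + 2 * M / D * (sqrt (real K) * D\<^sup>2)"
  proof (intro add_mono mult_left_mono order_refl sum_inverse_sqrt_le)
    have "(\<Sum>k = 1..K. sqrt (real k) * (d (k - 1) - d k)) \<le> sqrt (real K) * (D\<^sup>2 - d K)"
      by (rule weighted_telescope_le) (auto simp: mono_def d)
    also have "\<dots> \<le> sqrt (real K) * D\<^sup>2" using d(1)[of K] by (intro mult_left_mono) auto
    finally show "(\<Sum>k = 1..K. sqrt (real k) * (d (k - 1) - d k)) \<le> sqrt (real K) * D\<^sup>2" .
  qed (use M_pos D_pos in auto)
  also have "\<dots> = real K * (eps / 2) + 4 * M * D * sqrt (real K)"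
    using D_pos by (simp add: power2_eq_square)
  also have "4 * M * D * sqrt (real K) = 4 * M * D * (real K / sqrt (real K))"
    by (simp add: real_div_sqrt)
  also have "real K * (eps / 2) + \<dots> = real K * (eps / 2 + 4 * M * D / sqrt (real K))"
    by (simp add: distrib_left)
  finally show ?thesis using K by (simp add: divide_le_eq mult.commute)
qed

text \<open>
  The number \<open>64 r\<^sup>2\<close> of outer iterations is what makes \<open>4 M D / sqrt K\<close> at most \<open>eps / 2\<close>. The bound
  then comes from summing \<open>2 call_bound eps k\<close>, with \<open>K \<le> 64 r\<^sup>2 + 1\<close> after rounding up.
\<close>

lemma pbspp_complexity:
  defines "r \<equiv> M * D / eps"
  shows "finds_within P lam eps R (64 * r * sqrt (64 * r\<^sup>2 + 1) + (8 * sqrt r + 2) * (64 * r\<^sup>2 + 1))"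
proof -
  define K where "K = nat \<lceil>64 * r\<^sup>2\<rceil>"
  have r: "r > 0" using M_pos D_pos eps by (simp add: r_def)
  have K: "64 * r\<^sup>2 \<le> real K" "real K \<le> 64 * r\<^sup>2 + 1"
    unfolding K_def using zero_le_power2[of r] by linarith+
  have K1: "K \<ge> 1" using K(1) r by (cases K) auto
  have "\<forall>k. \<exists>Nx Ny. k \<ge> 1 \<longrightarrow> x_call_stops_at P lam eps R k Nx \<and> real Nx \<le> call_bound eps k \<and>
      y_call_stops_at P lam eps R k Ny \<and> real Ny \<le> call_bound eps k"
    using outer_invariant by blast
  then obtain Nx Ny where N: "\<And>k. k \<ge> 1 \<Longrightarrow> x_call_stops_at P lam eps R k (Nx k) \<and>
      real (Nx k) \<le> call_bound eps k \<and>
      y_call_stops_at P lam eps R k (Ny k) \<and> real (Ny k) \<le> call_bound eps k"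
    by metis
  have "8 * r \<le> sqrt (real K)"
    using K(1) by (intro real_le_rsqrt) (simp add: power2_eq_square)
  then have "4 * M * D / sqrt (real K) \<le> 4 * M * D / (8 * r)"
    using r M_pos D_pos K1 by (intro divide_left_mono) auto
  also have "\<dots> = eps / 2" using M_pos D_pos eps by (simp add: r_def)
  finally have half: "4 * M * D / sqrt (real K) \<le> eps / 2" .
  have "is_eps_saddle_point P eps (average K (seq_xt R)) (average K (seq_yt R))"
  proof (rule average_eps_saddle_point[OF K1])
    show "seq_xt R k \<in> dom1 P \<and> seq_yt R k \<in> dom2 P" if "k \<in> {1..K}" for k
      using that outer_step(1,2)[of k] by simp
    show "(\<Sum>k = 1..K. gap_term u v (seq_xt R k) (seq_yt R k)) / real K \<le> eps"
      if "u \<in> dom1 P" "v \<in> dom2 P" for u v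
      using average_gap_le[OF K1 that] half by linarith
  qed
  moreover have "real (\<Sum>i = 1..K. Nx i + Ny i)
      \<le> 64 * r * sqrt (64 * r\<^sup>2 + 1) + (8 * sqrt r + 2) * (64 * r\<^sup>2 + 1)"
  proof -
    have "real (\<Sum>i = 1..K. Nx i + Ny i) = (\<Sum>i = 1..K. real (Nx i) + real (Ny i))" by simp
    also have "\<dots> \<le> (\<Sum>i = 1..K. 32 * r * (1 / sqrt (real i)) + (8 * sqrt r + 2))"
    proof (rule sum_mono)
      fix i assume "i \<in> {1..K}"
      then have "real (Nx i) \<le> call_bound eps i" "real (Ny i) \<le> call_bound eps i"
        using N[of i] by simp_all
      then show "real (Nx i) + real (Ny i) \<le> 32 * r * (1 / sqrt (real i)) + (8 * sqrt r + 2)"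
        unfolding call_bound_def r_def[symmetric] by simp
    qed
    also have "\<dots> = 32 * r * (\<Sum>i = 1..K. 1 / sqrt (real i)) + (8 * sqrt r + 2) * real K"
      by (simp add: sum.distrib sum_distrib_left)
    also have "\<dots> \<le> 32 * r * (2 * sqrt (64 * r\<^sup>2 + 1)) + (8 * sqrt r + 2) * (64 * r\<^sup>2 + 1)"
      using r K(2) by (intro add_mono mult_left_mono order_trans[OF sum_inverse_sqrt_le]) auto
    finally show ?thesis by simp
  qed
  moreover have "\<forall>i\<in>{1..K}. x_call_stops_at P lam eps R i (Nx i) \<and> y_call_stops_at P lam eps R i (Ny i)"
    using N by simp
  ultimately show ?thesis unfolding finds_within_def using K1 by blast
qed

end

end

section \<open>The complexity bound\<close>

theorem theorem4p1:
  shows "\<exists>C :: real \<Rightarrow> real. C \<in> O(\<lambda>r. r powr 2.5) \<and>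
    (\<forall>(P :: spp) (M :: real) (D :: real) (eps :: real) (x0 :: rvec) (y0 :: rvec)
        (lam :: nat \<Rightarrow> real) (R :: pbspp_trace).
       spp_assumptions P M D \<longrightarrow> x0 \<in> dom1 P \<longrightarrow> y0 \<in> dom2 P \<longrightarrow> eps > 0 \<longrightarrow>
       lam 1 = D / (4 * M) \<longrightarrow> (\<forall>k\<ge>1. lam k = lam 1 / sqrt (real k)) \<longrightarrow>
       pbspp_run P (\<lambda>j. real j / (real j + 2)) lam eps x0 y0 R \<longrightarrow>
       finds_within P lam eps R (C (M * D / eps)))"
proof (intro exI conjI allI impI)
  define C :: "real \<Rightarrow> real"
    where "C r = 64 * r * sqrt (64 * r\<^sup>2 + 1) + (8 * sqrt r + 2) * (64 * r\<^sup>2 + 1)" for r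
  show "C \<in> O(\<lambda>r. r powr 2.5)" unfolding C_def by real_asymp
  fix P M D eps x0 y0 lam R
  assume "spp_assumptions P M D" and hyps: "x0 \<in> dom1 P" "y0 \<in> dom2 P" "eps > 0"
    "lam 1 = D / (4 * M)" "\<forall>k\<ge>1. lam k = lam 1 / sqrt (real k)"
    "pbspp_run P (\<lambda>j. real j / (real j + 2)) lam eps x0 y0 R"
  then interpret bounded_spp P M D by unfold_locales
  show "finds_within P lam eps R (C (M * D / eps))"
    unfolding C_def using hyps by (intro pbspp_complexity)
qed

end
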